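(* For every ordinal $\alpha$, $\overline{\mathbb{R}}_\alpha$ is connected in its order topology, i.e. the topology having as a base the sets $\{z\in\overline{\mathbb{R}}_\alpha : x<z<y\}$ with $x,y\in\overline{\mathbb{R}}_\alpha$.
   Context: For an ordinal $\alpha$, let $\mathbb{N}_\alpha$ be the set of ordinals strictly less than $\omega^{\omega^\alpha}$ with the ordinal order and the natural (Hessenberg) sum and product. Let $\mathbb{Z}_\alpha$ be the classes of pairs $(a,b)\in\mathbb{N}_\alpha^2$ under $(a,b)\sim(c,d)\iff a+d=b+c$, with $(a,b)+(c,d)=(a+c,b+d)$, $(a,b)(c,d)=(ac+bd,ad+bc)$, order $[(a_1,a_2)]\ge[(b_1,b_2)]\iff a_1+b_2\ge a_2+b_1$. Let $\mathbb{Q}_\alpha$ be its field of fractions (classes of $(a,b)$, $b\neq 0$, under $ad=bc$, usual fraction operations), ordered by: $A\ge 0$ iff $ab\ge0$ for representatives $(a,b)$ of $A$, and $A\ge B$ iff $A-B\ge0$. A Dedekind cut on a linearly ordered set $Q$ is a pair $(A,B)$ of subsets of $Q$ such that: every element of $A$ is less than every element of $B$; $Q\setminus(A\cup B)$ has at most one element; $\inf(B)\notin B$ and $\sup(A)\notin A$; $A\cap B=\varnothing$. Cuts are ordered by $(A_1,B_1)\ge(A_2,B_2)\iff A_2\subseteq A_1$. $\overline{\mathbb{R}}_\alpha$ is the set of all Dedekind cuts on $\mathbb{Q}_\alpha$ with this order.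
   Formalization: Cuts (A,B) must also have A downward and B upward closed, since the listed conditions let a point be deleted and connectedness then fails; open rays and the whole space are added to the intervals, which miss the least and greatest cuts and so are no base. *)

theory Defs
  imports "HOL-Analysis.Abstract_Topology" "HOL-Library.Poly_Mapping"
begin

section \<open>The ordinal powers of omega\<close>

text \<open>
  An ordinal is represented by a well-order \<open>s\<close>, and the ordinals strictly below it by the
  elements of \<open>Field s\<close>. The power \<open>omega ^ s\<close> is the usual synthetic ordinal exponential:
  finitely supported functions from \<open>s\<close> to the natural numbers, compared at the largest place
  where they differ. The function \<open>f\<close> is the ordinal with Cantor normal form
  \<open>\<Sum>k. omega ^ k * f k\<close>, the sum being taken in decreasing order of \<open>k\<close>.
\<close>

definition omega_pow :: "'b rel \<Rightarrow> ('b \<Rightarrow>\<^sub>0 nat) rel" where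
  "omega_pow s = {(f, g). Poly_Mapping.keys f \<subseteq> Field s \<and> Poly_Mapping.keys g \<subseteq> Field s \<and>
     (f = g \<or> (\<exists>k. Poly_Mapping.lookup f k < Poly_Mapping.lookup g k \<and>
        (\<forall>j. (k, j) \<in> s \<and> j \<noteq> k \<longrightarrow> Poly_Mapping.lookup f j = Poly_Mapping.lookup g j)))}"

lemma Field_omega_pow: "Field (omega_pow s) = {f. Poly_Mapping.keys f \<subseteq> Field s}"
  by (auto simp: omega_pow_def Field_def)


section \<open>The semiring of ordinals below omega to the omega to the alpha\<close>

text \<open>
  Hessenberg's operations are defined on Cantor normal forms. The natural sum adds coefficients,
  so it is \<open>+\<close> on \<open>\<Rightarrow>\<^sub>0\<close>, both for the elements of \<open>omega ^ (omega ^ \<alpha>)\<close> and for their exponents,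
  which are elements of \<open>omega ^ \<alpha>\<close>. The natural product multiplies normal forms out like
  polynomials in \<open>omega\<close>, adding exponents by the natural sum; this convolution is \<open>*\<close> on
  \<open>('a \<Rightarrow>\<^sub>0 nat) \<Rightarrow>\<^sub>0 nat\<close>. The type \<open>'a\<close> carries no order; the type-class order of \<open>\<Rightarrow>\<^sub>0\<close> is
  not used.
\<close>

type_synonym 'a N_ord = "('a \<Rightarrow>\<^sub>0 nat) \<Rightarrow>\<^sub>0 nat"
type_synonym 'a Z_ord = "('a N_ord \<times> 'a N_ord) set"
type_synonym 'a Q_ord = "('a Z_ord \<times> 'a Z_ord) set"

definition N_le :: "'a rel \<Rightarrow> 'a N_ord rel" where
  "N_le \<alpha> = omega_pow (omega_pow \<alpha>)"

definition N_set :: "'a rel \<Rightarrow> 'a N_ord set" where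
  "N_set \<alpha> = Field (N_le \<alpha>)"


section \<open>The ordered ring of differences\<close>

definition Z_rel :: "'a rel \<Rightarrow> ('a N_ord \<times> 'a N_ord) rel" where
  "Z_rel \<alpha> = {((a, b), (c, d)). a \<in> N_set \<alpha> \<and> b \<in> N_set \<alpha> \<and> c \<in> N_set \<alpha> \<and> d \<in> N_set \<alpha> \<and>
     a + d = b + c}"

definition Z_set :: "'a rel \<Rightarrow> 'a Z_ord set" where
  "Z_set \<alpha> = (N_set \<alpha> \<times> N_set \<alpha>) // Z_rel \<alpha>"

definition Z_class :: "'a rel \<Rightarrow> 'a N_ord \<Rightarrow> 'a N_ord \<Rightarrow> 'a Z_ord" where
  "Z_class \<alpha> a b = Z_rel \<alpha> `` {(a, b)}"

definition Z_zero :: "'a rel \<Rightarrow> 'a Z_ord" where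
  "Z_zero \<alpha> = Z_class \<alpha> 0 0"

definition Z_add :: "'a rel \<Rightarrow> 'a Z_ord \<Rightarrow> 'a Z_ord \<Rightarrow> 'a Z_ord" where
  "Z_add \<alpha> X Y = (\<Union>(a, b)\<in>X. \<Union>(c, d)\<in>Y. Z_class \<alpha> (a + c) (b + d))"

definition Z_uminus :: "'a rel \<Rightarrow> 'a Z_ord \<Rightarrow> 'a Z_ord" where
  "Z_uminus \<alpha> X = (\<Union>(a, b)\<in>X. Z_class \<alpha> b a)"

definition Z_mult :: "'a rel \<Rightarrow> 'a Z_ord \<Rightarrow> 'a Z_ord \<Rightarrow> 'a Z_ord" where
  "Z_mult \<alpha> X Y = (\<Union>(a, b)\<in>X. \<Union>(c, d)\<in>Y. Z_class \<alpha> (a * c + b * d) (a * d + b * c))"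

definition Z_le :: "'a rel \<Rightarrow> 'a Z_ord \<Rightarrow> 'a Z_ord \<Rightarrow> bool" where
  "Z_le \<alpha> Y X \<longleftrightarrow> (\<exists>(a1, a2)\<in>X. \<exists>(b1, b2)\<in>Y. (a2 + b1, a1 + b2) \<in> N_le \<alpha>)"


section \<open>The ordered field of fractions\<close>

definition Q_pairs :: "'a rel \<Rightarrow> ('a Z_ord \<times> 'a Z_ord) set" where
  "Q_pairs \<alpha> = Z_set \<alpha> \<times> (Z_set \<alpha> - {Z_zero \<alpha>})"

definition Q_rel :: "'a rel \<Rightarrow> ('a Z_ord \<times> 'a Z_ord) rel" where
  "Q_rel \<alpha> = {((a, b), (c, d)). (a, b) \<in> Q_pairs \<alpha> \<and> (c, d) \<in> Q_pairs \<alpha> \<and>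
     Z_mult \<alpha> a d = Z_mult \<alpha> b c}"

definition Q_set :: "'a rel \<Rightarrow> 'a Q_ord set" where
  "Q_set \<alpha> = Q_pairs \<alpha> // Q_rel \<alpha>"

definition Q_class :: "'a rel \<Rightarrow> 'a Z_ord \<Rightarrow> 'a Z_ord \<Rightarrow> 'a Q_ord" where
  "Q_class \<alpha> a b = Q_rel \<alpha> `` {(a, b)}"

definition Q_add :: "'a rel \<Rightarrow> 'a Q_ord \<Rightarrow> 'a Q_ord \<Rightarrow> 'a Q_ord" where
  "Q_add \<alpha> X Y = (\<Union>(a, b)\<in>X. \<Union>(c, d)\<in>Y.
     Q_class \<alpha> (Z_add \<alpha> (Z_mult \<alpha> a d) (Z_mult \<alpha> b c)) (Z_mult \<alpha> b d))"

definition Q_uminus :: "'a rel \<Rightarrow> 'a Q_ord \<Rightarrow> 'a Q_ord" where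
  "Q_uminus \<alpha> X = (\<Union>(a, b)\<in>X. Q_class \<alpha> (Z_uminus \<alpha> a) b)"

definition Q_mult :: "'a rel \<Rightarrow> 'a Q_ord \<Rightarrow> 'a Q_ord \<Rightarrow> 'a Q_ord" where
  "Q_mult \<alpha> X Y = (\<Union>(a, b)\<in>X. \<Union>(c, d)\<in>Y. Q_class \<alpha> (Z_mult \<alpha> a c) (Z_mult \<alpha> b d))"

definition Q_nonneg :: "'a rel \<Rightarrow> 'a Q_ord \<Rightarrow> bool" where
  "Q_nonneg \<alpha> X \<longleftrightarrow> (\<exists>(a, b)\<in>X. Z_le \<alpha> (Z_zero \<alpha>) (Z_mult \<alpha> a b))"

definition Q_le :: "'a rel \<Rightarrow> 'a Q_ord \<Rightarrow> 'a Q_ord \<Rightarrow> bool" where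
  "Q_le \<alpha> Y X \<longleftrightarrow> Q_nonneg \<alpha> (Q_add \<alpha> X (Q_uminus \<alpha> Y))"


section \<open>Dedekind cuts\<close>

definition is_inf_in :: "'q set \<Rightarrow> ('q \<Rightarrow> 'q \<Rightarrow> bool) \<Rightarrow> 'q set \<Rightarrow> 'q \<Rightarrow> bool" where
  "is_inf_in Q le S m \<longleftrightarrow> m \<in> Q \<and> (\<forall>s\<in>S. le m s) \<and> (\<forall>l\<in>Q. (\<forall>s\<in>S. le l s) \<longrightarrow> le l m)"

definition is_sup_in :: "'q set \<Rightarrow> ('q \<Rightarrow> 'q \<Rightarrow> bool) \<Rightarrow> 'q set \<Rightarrow> 'q \<Rightarrow> bool" where
  "is_sup_in Q le S m \<longleftrightarrow> is_inf_in Q (\<lambda>x y. le y x) S m"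

text \<open>
  The conditions on the infimum and the supremum are vacuous when these do not exist in \<open>Q\<close>.
  The second line makes explicit that a cut consists of an initial and a final segment. The other
  conditions alone do not imply this: in the rationals they also allow an arbitrary single point
  to be removed from one side of an irrational cut, and then comparing cuts by inclusion of their
  lower parts is not even antisymmetric.
\<close>

definition dedekind_cut :: "'q set \<Rightarrow> ('q \<Rightarrow> 'q \<Rightarrow> bool) \<Rightarrow> 'q set \<times> 'q set \<Rightarrow> bool" where
  "dedekind_cut Q le = (\<lambda>(A, B).
     A \<subseteq> Q \<and> B \<subseteq> Q \<and>
     (\<forall>a\<in>A. \<forall>q\<in>Q. le q a \<longrightarrow> q \<in> A) \<and> (\<forall>b\<in>B. \<forall>q\<in>Q. le b q \<longrightarrow> q \<in> B) \<and>
     (\<forall>a\<in>A. \<forall>b\<in>B. le a b \<and> a \<noteq> b) \<and>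
     (\<forall>p\<in>Q - (A \<union> B). \<forall>q\<in>Q - (A \<union> B). p = q) \<and>
     (\<forall>m. is_inf_in Q le B m \<longrightarrow> m \<notin> B) \<and>
     (\<forall>m. is_sup_in Q le A m \<longrightarrow> m \<notin> A) \<and>
     A \<inter> B = {})"

definition cut_le :: "'q set \<times> 'q set \<Rightarrow> 'q set \<times> 'q set \<Rightarrow> bool" where
  "cut_le C D \<longleftrightarrow> fst C \<subseteq> fst D"

definition R_bar :: "'a rel \<Rightarrow> ('a Q_ord set \<times> 'a Q_ord set) set" where
  "R_bar \<alpha> = {C. dedekind_cut (Q_set \<alpha>) (Q_le \<alpha>) C}"


section \<open>The order topology on a set\<close>

text \<open>
  The open rays are needed besides the bounded open intervals because \<open>R_bar \<alpha>\<close> has a least and a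
  greatest element, \<open>({}, Q)\<close> and \<open>(Q, {})\<close>, which lie in no bounded open interval.
\<close>

definition order_topology_on :: "'c set \<Rightarrow> ('c \<Rightarrow> 'c \<Rightarrow> bool) \<Rightarrow> 'c topology" where
  "order_topology_on X le = (let less = (\<lambda>x y. le x y \<and> x \<noteq> y) in
     topology_generated_by
       ({{z \<in> X. less x z \<and> less z y} | x y. x \<in> X \<and> y \<in> X} \<union>
        {{z \<in> X. less x z} | x. x \<in> X} \<union> {{z \<in> X. less z y} | y. y \<in> X} \<union> {X}))"

lemma topspace_order_topology_on: "topspace (order_topology_on X le) = X"
  unfolding order_topology_on_def Let_def topology_generated_by_topspace by auto


section \<open>Powers of omega are well-orders\<close>

lemma omega_pow_lessI:
  assumes "Poly_Mapping.keys f \<subseteq> Field s" "Poly_Mapping.keys g \<subseteq> Field s"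
    and "Poly_Mapping.lookup f k < Poly_Mapping.lookup g k"
    and "\<And>j. (k, j) \<in> s \<Longrightarrow> j \<noteq> k \<Longrightarrow> Poly_Mapping.lookup f j = Poly_Mapping.lookup g j"
  shows "(f, g) \<in> omega_pow s"
  using assms unfolding omega_pow_def by blast

lemma omega_pow_lessE:
  assumes "(f, g) \<in> omega_pow s" "f \<noteq> g"
  obtains k where "k \<in> Field s" "Poly_Mapping.lookup f k < Poly_Mapping.lookup g k"
    "\<And>j. (k, j) \<in> s \<Longrightarrow> j \<noteq> k \<Longrightarrow> Poly_Mapping.lookup f j = Poly_Mapping.lookup g j"
proof -
  obtain k where k: "Poly_Mapping.lookup f k < Poly_Mapping.lookup g k"
    "\<And>j. (k, j) \<in> s \<Longrightarrow> j \<noteq> k \<Longrightarrow> Poly_Mapping.lookup f j = Poly_Mapping.lookup g j"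
    and g: "Poly_Mapping.keys g \<subseteq> Field s"
    using assms unfolding omega_pow_def by blast
  have "k \<in> Poly_Mapping.keys g" using k(1) by (simp add: in_keys_iff)
  then show thesis using that[of k] k g by blast
qed

lemma finite_has_max:
  assumes s: "Well_order s" and K: "finite K" "K \<noteq> {}" "K \<subseteq> Field s"
  shows "\<exists>k\<in>K. \<forall>j\<in>K. (j, k) \<in> s"
  using K(1,2,3)
proof (induction rule: finite_ne_induct)
  case (singleton x)
  interpret wo_rel s by (simp add: wo_rel_def s)
  show ?case using singleton TOTALS by auto
next
  case (insert x F)
  interpret wo_rel s by (simp add: wo_rel_def s)
  from insert obtain k where k: "k \<in> F" "\<forall>j\<in>F. (j, k) \<in> s" by auto
  have kx: "(k, x) \<in> s \<or> (x, k) \<in> s" "(x,x) \<in> s" using TOTALS insert k by auto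
  show ?case
  proof (cases "(x, k) \<in> s")
    case True then show ?thesis using k by auto
  next
    case False
    then have "(k, x) \<in> s" using kx by blast
    then have "\<forall>j\<in>F. (j, x) \<in> s" using k TRANS by (meson transD)
    then show ?thesis using kx by auto
  qed
qed

lemma omega_pow_total:
  assumes s: "Well_order s" and "Poly_Mapping.keys f \<subseteq> Field s" "Poly_Mapping.keys g \<subseteq> Field s"
  shows "(f, g) \<in> omega_pow s \<or> (g, f) \<in> omega_pow s"
proof (cases "f = g")
  case True then show ?thesis using assms by (auto simp: omega_pow_def)
next
  case False
  interpret wo_rel s by (simp add: wo_rel_def s)
  define K where "K = {k. Poly_Mapping.lookup f k \<noteq> Poly_Mapping.lookup g k}"
  have sub: "K \<subseteq> Poly_Mapping.keys f \<union> Poly_Mapping.keys g" by (auto simp: K_def in_keys_iff)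
  have "finite K" using sub by (rule finite_subset) simp
  moreover have "K \<noteq> {}" using False poly_mapping_eqI[of f g] unfolding K_def by blast
  moreover have "K \<subseteq> Field s" using sub assms by blast
  ultimately obtain k where k: "k \<in> K" "\<forall>j\<in>K. (j, k) \<in> s" using finite_has_max[OF s] by meson
  have eq: "Poly_Mapping.lookup f j = Poly_Mapping.lookup g j" if "(k, j) \<in> s" "j \<noteq> k" for j
    using k that ANTISYM unfolding K_def by (metis (mono_tags) antisymD mem_Collect_eq)
  have "Poly_Mapping.lookup f k < Poly_Mapping.lookup g k \<or> Poly_Mapping.lookup g k < Poly_Mapping.lookup f k"
    using k(1) by (auto simp: K_def)
  then show ?thesis
  proof
    assume "Poly_Mapping.lookup f k < Poly_Mapping.lookup g k"
    then show ?thesis using eq by (intro disjI1 omega_pow_lessI[OF assms(2,3)]) auto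
  next
    assume "Poly_Mapping.lookup g k < Poly_Mapping.lookup f k"
    then show ?thesis using eq by (intro disjI2 omega_pow_lessI[OF assms(3,2)]) auto
  qed
qed

lemma omega_pow_has_min:
  assumes s: "Well_order s"
    and D: "D \<subseteq> Field s" "\<And>k j. k \<in> D \<Longrightarrow> (j, k) \<in> s \<Longrightarrow> j \<in> D"
    and T: "T \<noteq> {}" "\<And>f. f \<in> T \<Longrightarrow> Poly_Mapping.keys f \<subseteq> Field s"
    and agree: "\<And>f g j. f \<in> T \<Longrightarrow> g \<in> T \<Longrightarrow> j \<notin> D \<Longrightarrow> Poly_Mapping.lookup f j = Poly_Mapping.lookup g j"
    and IH: "\<And>m U. m \<in> D \<Longrightarrow> U \<noteq> {} \<Longrightarrow> U \<subseteq> T \<Longrightarrow>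
        (\<And>f g j. f \<in> U \<Longrightarrow> g \<in> U \<Longrightarrow> (j, m) \<notin> s - Id \<Longrightarrow> Poly_Mapping.lookup f j = Poly_Mapping.lookup g j) \<Longrightarrow>
        \<exists>g\<in>U. \<forall>f\<in>U. (g, f) \<in> omega_pow s"
  shows "\<exists>g\<in>T. \<forall>f\<in>T. (g, f) \<in> omega_pow s"
proof -
  interpret wo_rel s by (simp add: wo_rel_def s)
  note lt = TRANS[THEN transD] and as = ANTISYM[THEN antisymD]
  have lead: "\<exists>k\<in>Poly_Mapping.keys f \<inter> D. \<forall>j\<in>Poly_Mapping.keys f \<inter> D. (j, k) \<in> s"
    if "f \<in> T" "Poly_Mapping.keys f \<inter> D \<noteq> {}" for f
    using that T(2)[OF that(1)] by (intro finite_has_max[OF s]) auto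
  show ?thesis
  proof (cases "\<exists>g\<in>T. Poly_Mapping.keys g \<inter> D = {}")
    case True
    then obtain g where g: "g \<in> T" "Poly_Mapping.keys g \<inter> D = {}" by blast
    have "(g, f) \<in> omega_pow s" if f: "f \<in> T" for f
    proof (cases "Poly_Mapping.keys f \<inter> D = {}")
      case True
      have "Poly_Mapping.lookup f j = Poly_Mapping.lookup g j" for j
      proof (cases "j \<in> D")
        case jD: True
        have "j \<notin> Poly_Mapping.keys f" "j \<notin> Poly_Mapping.keys g" using True g jD by blast+
        then show ?thesis by (simp add: in_keys_iff)
      qed (simp add: agree[OF f g(1)])
      then have "f = g" by (rule poly_mapping_eqI)
      then show ?thesis using T(2) f by (auto simp: omega_pow_def)
    next
      case False
      then obtain k where k: "k \<in> Poly_Mapping.keys f" "k \<in> D"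
        "\<And>j. j \<in> Poly_Mapping.keys f \<Longrightarrow> j \<in> D \<Longrightarrow> (j, k) \<in> s" using lead[OF f] by blast
      show ?thesis
      proof (rule omega_pow_lessI[of _ _ _ k])
        have "k \<notin> Poly_Mapping.keys g" using k(2) g(2) by blast
        then show "Poly_Mapping.lookup g k < Poly_Mapping.lookup f k"
          using k(1) by (simp add: in_keys_iff)
        fix j assume j: "(k, j) \<in> s" "j \<noteq> k"
        show "Poly_Mapping.lookup g j = Poly_Mapping.lookup f j"
        proof (cases "j \<in> D")
          case True
          then have "j \<notin> Poly_Mapping.keys f" using k(3) j as by blast
          moreover have "j \<notin> Poly_Mapping.keys g" using True g by blast
          ultimately show ?thesis by (simp add: in_keys_iff)
        qed (simp add: agree[OF f g(1)])
      qed (use T f g in auto)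
    qed
    with g show ?thesis by blast
  next
    case False
    define P where "P m f \<longleftrightarrow> f \<in> T \<and> m \<in> Poly_Mapping.keys f \<and> m \<in> D \<and>
       (\<forall>j\<in>Poly_Mapping.keys f \<inter> D. (j, m) \<in> s)" for m f
    have exP: "\<exists>m. P m f" if "f \<in> T" for f using lead[OF that] False that unfolding P_def by blast
    define M where "M = {m. \<exists>f. P m f}"
    have M: "M \<noteq> {}" using exP T(1) unfolding M_def by blast
    have MF: "M \<subseteq> Field s" using D(1) unfolding M_def P_def by blast
    define m where "m = minim M"
    have m: "m \<in> M" "\<And>k. k \<in> M \<Longrightarrow> (m, k) \<in> s"
      unfolding m_def using minim_in[OF MF M] minim_least[OF MF] by auto
    define c where "c = (LEAST c. \<exists>f. P m f \<and> Poly_Mapping.lookup f m = c)"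
    have c: "\<exists>f. P m f \<and> Poly_Mapping.lookup f m = c"
      unfolding c_def by (rule LeastI_ex) (use m(1) in \<open>auto simp: M_def\<close>)
    have cmin: "c \<le> Poly_Mapping.lookup f m" if "P m f" for f
      unfolding c_def by (rule Least_le) (use that in auto)
    define U where "U = {f. P m f \<and> Poly_Mapping.lookup f m = c}"
    have mD: "m \<in> D" using m(1) by (auto simp: M_def P_def)
    have zero: "Poly_Mapping.lookup f j = 0" if "P k f" "j \<in> D" "(j, k) \<notin> s" for f j k
      using that by (auto simp: P_def in_keys_iff)
    have "\<exists>g\<in>U. \<forall>f\<in>U. (g, f) \<in> omega_pow s"
    proof (rule IH[OF mD])
      show "U \<noteq> {}" "U \<subseteq> T" using c by (auto simp: U_def P_def)
      fix f g j assume fg: "f \<in> U" "g \<in> U" and j: "(j, m) \<notin> s - Id"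
      show "Poly_Mapping.lookup f j = Poly_Mapping.lookup g j"
      proof (cases "j \<in> D \<and> j \<noteq> m")
        case True
        then show ?thesis using zero[of m _ j] j fg by (auto simp: U_def)
      next
        case False
        then show ?thesis using fg agree[of f g j] by (auto simp: U_def P_def)
      qed
    qed
    then obtain g where g: "g \<in> U" "\<And>f. f \<in> U \<Longrightarrow> (g, f) \<in> omega_pow s" by blast
    have gP: "P m g" "g \<in> T" "Poly_Mapping.lookup g m = c" using g(1) by (auto simp: U_def P_def)
    have "(g, f) \<in> omega_pow s" if f: "f \<in> T" for f
    proof -
      obtain k where k: "P k f" using exP[OF f] by blast
      then have mk: "(m, k) \<in> s" using m(2) by (auto simp: M_def)
      have same: "Poly_Mapping.lookup g j = Poly_Mapping.lookup f j" if j: "(k, j) \<in> s" "j \<noteq> k" for j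
      proof (cases "j \<in> D")
        case True
        have "(j, k) \<notin> s" using j as by blast
        moreover have "(j, m) \<notin> s" using calculation mk lt by blast
        ultimately show ?thesis using zero[OF k True] zero[OF gP(1) True] by simp
      qed (simp add: agree[OF f gP(2)])
      have kD: "k \<in> D" using k by (auto simp: P_def)
      consider "k \<noteq> m" | "k = m" "Poly_Mapping.lookup f m \<noteq> c" | "f \<in> U"
        using k by (auto simp: U_def)
      then show ?thesis
      proof cases
        case 1
        then have "(k, m) \<notin> s" using mk as by blast
        then have "Poly_Mapping.lookup g k < Poly_Mapping.lookup f k"
          using zero[OF gP(1) kD] k by (auto simp: P_def in_keys_iff)
        then show ?thesis using same T(2) f gP(2) by (intro omega_pow_lessI[of _ _ _ k]) auto
      next
        case 2
        then have "Poly_Mapping.lookup g k < Poly_Mapping.lookup f k"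
          using cmin[of f] k gP(3) by auto
        then show ?thesis using same T(2) f gP(2) by (intro omega_pow_lessI[of _ _ _ k]) auto
      qed (use g in blast)
    qed
    then show ?thesis using gP by blast
  qed
qed

lemma omega_pow_min_below:
  assumes s: "Well_order s"
    and T: "T \<noteq> {}" "\<And>f. f \<in> T \<Longrightarrow> Poly_Mapping.keys f \<subseteq> Field s"
    and "\<And>f g j. f \<in> T \<Longrightarrow> g \<in> T \<Longrightarrow> (j, m) \<notin> s - Id \<Longrightarrow> Poly_Mapping.lookup f j = Poly_Mapping.lookup g j"
  shows "\<exists>g\<in>T. \<forall>f\<in>T. (g, f) \<in> omega_pow s"
proof -
  interpret wo_rel s by (simp add: wo_rel_def s)
  show ?thesis
    using T assms(4)
  proof (induction m arbitrary: T rule: wf_induct_rule[OF WF])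
    case (1 m)
    show ?case
    proof (rule omega_pow_has_min[OF s, of "{j. (j, m) \<in> s - Id}"], goal_cases)
      case (2 k j)
      then have "(j, m) \<in> s" "j \<noteq> m"
        using TRANS[THEN transD, of j k m] ANTISYM[THEN antisymD, of m k] by auto
      then show ?case by simp
    next
      case (6 k U)
      show ?case
      proof (rule "1.IH"[of k U])
        show "Poly_Mapping.keys f \<subseteq> Field s" if "f \<in> U" for f
          using that 6(3) by (intro 1(3)) blast
        show "Poly_Mapping.lookup f j = Poly_Mapping.lookup g j"
          if "f \<in> U" "g \<in> U" "(j, k) \<notin> s - Id" for f g j
          using 6(4)[OF that] .
        show "(k, m) \<in> s - Id" using 6(1) by blast
        show "U \<noteq> {}" by (rule 6(2))
      qed
    next
      case (5 f g j)
      then show ?case using 1(4)[of f g j] by simp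
    next
      case 1
      show ?case by (auto intro: FieldI1)
    next
      case 3
      show ?case by (rule "1.prems"(1))
    next
      case (4 f)
      then show ?case by (rule "1.prems"(2))
    qed
  qed
qed

lemma Well_order_omega_pow:
  assumes s: "Well_order s"
  shows "Well_order (omega_pow s)"
proof -
  interpret wo_rel s by (simp add: wo_rel_def s)
  have anti: "antisym (omega_pow s)" and tr: "trans (omega_pow s)"
  proof -
    have key: "\<exists>k. Poly_Mapping.lookup f k < Poly_Mapping.lookup h k \<and>
        (\<forall>j. (k, j) \<in> s \<and> j \<noteq> k \<longrightarrow> Poly_Mapping.lookup f j = Poly_Mapping.lookup h j)"
      if fgh: "(f, g) \<in> omega_pow s" "(g, h) \<in> omega_pow s" "f \<noteq> g" "g \<noteq> h" for f g h
    proof -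
      obtain k where k: "k \<in> Field s" "Poly_Mapping.lookup f k < Poly_Mapping.lookup g k"
        "\<And>j. (k, j) \<in> s \<Longrightarrow> j \<noteq> k \<Longrightarrow> Poly_Mapping.lookup f j = Poly_Mapping.lookup g j"
        using omega_pow_lessE[OF fgh(1,3)] by blast
      obtain l where l: "l \<in> Field s" "Poly_Mapping.lookup g l < Poly_Mapping.lookup h l"
        "\<And>j. (l, j) \<in> s \<Longrightarrow> j \<noteq> l \<Longrightarrow> Poly_Mapping.lookup g j = Poly_Mapping.lookup h j"
        using omega_pow_lessE[OF fgh(2,4)] by blast
      consider "k = l" | "(k, l) \<in> s" "k \<noteq> l" | "(l, k) \<in> s" "k \<noteq> l" using TOTALS k l by blast
      then show ?thesis
      proof cases
        case 1 then show ?thesis using k l by (intro exI[of _ k]) auto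
      next
        case 2
        have "\<And>j. (l, j) \<in> s \<Longrightarrow> j \<noteq> l \<Longrightarrow> (k, j) \<in> s \<and> j \<noteq> k"
          using 2 TRANS[THEN transD] ANTISYM[THEN antisymD] by blast
        then show ?thesis using k l 2 by (intro exI[of _ l]) auto
      next
        case 3
        have "\<And>j. (k, j) \<in> s \<Longrightarrow> j \<noteq> k \<Longrightarrow> (l, j) \<in> s \<and> j \<noteq> l"
          using 3 TRANS[THEN transD] ANTISYM[THEN antisymD] by blast
        then show ?thesis using k l 3 by (intro exI[of _ k]) auto
      qed
    qed
    show "antisym (omega_pow s)"
    proof (rule antisymI, rule ccontr)
      fix f g assume "(f, g) \<in> omega_pow s" "(g, f) \<in> omega_pow s" "f \<noteq> g"
      then show False using key[of f g f] by blast
    qed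
    show "trans (omega_pow s)"
    proof (rule transI)
      fix f g h assume *: "(f, g) \<in> omega_pow s" "(g, h) \<in> omega_pow s"
      show "(f, h) \<in> omega_pow s"
      proof (cases "f = g \<or> g = h")
        case False
        then show ?thesis using key[OF *] * by (auto simp: omega_pow_def)
      qed (use * in auto)
    qed
  qed
  have tot: "total_on (Field (omega_pow s)) (omega_pow s)"
    using omega_pow_total[OF s] by (auto simp: total_on_def Field_omega_pow)
  have lin: "Linear_order (omega_pow s)"
    unfolding linear_order_on_def partial_order_on_def preorder_on_def
    using anti tr tot by (auto simp: refl_on_def Field_omega_pow intro: FieldI1 FieldI2)
       (auto simp: omega_pow_def)
  have "\<exists>g\<in>T. \<forall>f\<in>T. (g, f) \<in> omega_pow s" if T: "T \<subseteq> Field (omega_pow s)" "T \<noteq> {}" for T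
  proof (rule omega_pow_has_min[OF s, of "Field s"], goal_cases)
    case (5 f g j)
    then have "j \<notin> Poly_Mapping.keys f" "j \<notin> Poly_Mapping.keys g"
      using T by (auto simp: Field_omega_pow)
    then show ?case by (simp add: in_keys_iff)
  next
    case (6 m U)
    show ?case
    proof (rule omega_pow_min_below[OF s, of U m])
      show "Poly_Mapping.keys f \<subseteq> Field s" if "f \<in> U" for f
        using that 6 T(1) unfolding Field_omega_pow by blast
      show "Poly_Mapping.lookup f j = Poly_Mapping.lookup g j"
        if "f \<in> U" "g \<in> U" "(j, m) \<notin> s - Id" for f g j
        using 6(4)[OF that] .
    qed (use 6(2) in simp)
  next
    case (2 k j)
    then show ?case by (simp add: FieldI1)
  qed (use T in \<open>auto simp: Field_omega_pow\<close>)
  then show ?thesis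
    using Linear_order_Well_order_iff[OF lin] by blast
qed

end

(*
  Taking differences identifies Z_alpha with the ring of polynomials with integer coefficients whose
  exponents are ordinals below omega^alpha, and there the order says that the leading coefficient is
  positive.  The natural sum of exponents is strictly monotone, so leading coefficients multiply and
  the positive elements form the positive cone of an ordered domain.  Hence its fractions are
  linearly ordered, and densely so, because midpoints exist.

  The upper half of a cut on a dense linear order is determined by the lower half, and the lower
  halves are exactly the initial segments without a maximum.  Ordered by inclusion these are again
  dense, and unions are suprema, so the space of cuts is a linear continuum and the usual supremum
  argument gives connectedness.
*)
theory Submission
  imports Defs
begin

section \<open>Dense linear orders on a set\<close>

text \<open>Elements of the field are sets of pairs of sets of pairs, which are awkward to calculate
  with. All algebra therefore takes place in the ring type
  \<open>('a \<Rightarrow>\<^sub>0 nat) \<Rightarrow>\<^sub>0 int\<close> and on pairs of its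
  elements. A class serves only as a name for such an object, and every operation on classes is
  shown to be the corresponding operation on polynomials. The ring type may also contain polynomials
  with exponents outside \<open>Field (omega_pow \<alpha>)\<close>, where the order of exponents is
  not total; hence positivity is axiomatised relative to a carrier set. Denominators may have either
  sign, so inequalities between fractions are treated by multiplying with squares rather than by
  distinguishing signs. On the order side, one notion of dense linear order serves twice: for the
  fractions, and again for the cuts on them. Since there is a least and a greatest cut, a
  neighbourhood has to be described separately on each side of a point.\<close>

locale dense_order_on =
  fixes X :: "'c set" and le :: "'c \<Rightarrow> 'c \<Rightarrow> bool"
  assumes le_refl: "x \<in> X \<Longrightarrow> le x x"
    and le_antisym: "x \<in> X \<Longrightarrow> y \<in> X \<Longrightarrow> le x y \<Longrightarrow> le y x \<Longrightarrow> x = y"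
    and le_trans: "x \<in> X \<Longrightarrow> y \<in> X \<Longrightarrow> z \<in> X \<Longrightarrow> le x y \<Longrightarrow> le y z \<Longrightarrow> le x z"
    and le_total: "x \<in> X \<Longrightarrow> y \<in> X \<Longrightarrow> le x y \<or> le y x"
    and dense: "x \<in> X \<Longrightarrow> y \<in> X \<Longrightarrow> le x y \<Longrightarrow> x \<noteq> y \<Longrightarrow>
      \<exists>z\<in>X. le x z \<and> x \<noteq> z \<and> le z y \<and> z \<noteq> y"
begin

definition less :: "'c \<Rightarrow> 'c \<Rightarrow> bool" where
  "less x y \<longleftrightarrow> le x y \<and> x \<noteq> y"

lemma less_iff_not_le: "x \<in> X \<Longrightarrow> y \<in> X \<Longrightarrow> less x y \<longleftrightarrow> \<not> le y x"
  unfolding less_def using le_total le_antisym le_refl by blast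

lemma less_trans: "x \<in> X \<Longrightarrow> y \<in> X \<Longrightarrow> z \<in> X \<Longrightarrow> less x y \<Longrightarrow> less y z \<Longrightarrow> less x z"
  unfolding less_def using le_trans le_antisym by metis

lemma less_le_trans: "x \<in> X \<Longrightarrow> y \<in> X \<Longrightarrow> z \<in> X \<Longrightarrow> less x y \<Longrightarrow> le y z \<Longrightarrow> less x z"
  unfolding less_def using le_trans le_antisym by metis

lemma le_less_trans: "x \<in> X \<Longrightarrow> y \<in> X \<Longrightarrow> z \<in> X \<Longrightarrow> le x y \<Longrightarrow> less y z \<Longrightarrow> less x z"
  unfolding less_def using le_trans le_antisym by metis

lemma less_dense: "x \<in> X \<Longrightarrow> y \<in> X \<Longrightarrow> less x y \<Longrightarrow> \<exists>z\<in>X. less x z \<and> less z y"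
  using dense[of x y] unfolding less_def by blast

text \<open>Openness in a generated topology is an inductive predicate, so the claim goes by
  induction over the generation of \<open>W\<close>. Each half is conditional on some point existing
  on that side of \<open>s\<close>, which makes it vacuous at an endpoint of the order. The two
  halves stay separate because the supremum argument approaches its point from one side at a
  time.\<close>

lemma openin_order_topology_nbhd:
  assumes "openin (order_topology_on X le) W" "s \<in> W"
  shows "(\<forall>a\<in>X. less a s \<longrightarrow> (\<exists>y\<in>X. less y s \<and> (\<forall>x\<in>X. less y x \<and> le x s \<longrightarrow> x \<in> W))) \<and>
    (\<forall>b\<in>X. less s b \<longrightarrow> (\<exists>y\<in>X. less s y \<and> (\<forall>x\<in>X. less x y \<and> le s x \<longrightarrow> x \<in> W)))"
proof -
  let ?S = "{{z \<in> X. less x z \<and> less z y} | x y. x \<in> X \<and> y \<in> X} \<union>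
        {{z \<in> X. less x z} | x. x \<in> X} \<union> {{z \<in> X. less z y} | y. y \<in> X} \<union> {X}"
  have "generate_topology_on ?S W"
    using assms(1)
    unfolding order_topology_on_def Let_def less_def openin_topology_generated_by_iff .
  then show ?thesis using assms(2)
  proof (induction arbitrary: s)
    case Empty
    then show ?case by simp
  next
    case (Int U V)
    have lo: "\<forall>a\<in>X. less a s \<longrightarrow> (\<exists>y\<in>X. less y s \<and> (\<forall>x\<in>X. less y x \<and> le x s \<longrightarrow> x \<in> U))"
         "\<forall>a\<in>X. less a s \<longrightarrow> (\<exists>y\<in>X. less y s \<and> (\<forall>x\<in>X. less y x \<and> le x s \<longrightarrow> x \<in> V))"
      and hi: "\<forall>b\<in>X. less s b \<longrightarrow> (\<exists>y\<in>X. less s y \<and> (\<forall>x\<in>X. less x y \<and> le s x \<longrightarrow> x \<in> U))"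
         "\<forall>b\<in>X. less s b \<longrightarrow> (\<exists>y\<in>X. less s y \<and> (\<forall>x\<in>X. less x y \<and> le s x \<longrightarrow> x \<in> V))"
      using Int.IH Int.prems by blast+
    show ?case
    proof (intro conjI ballI impI)
      fix a assume a: "a \<in> X" "less a s"
      obtain y where y: "y \<in> X" "less y s" "\<forall>x\<in>X. less y x \<and> le x s \<longrightarrow> x \<in> U"
        using lo(1) a by blast
      obtain z where z: "z \<in> X" "less z s" "\<forall>x\<in>X. less z x \<and> le x s \<longrightarrow> x \<in> V"
        using lo(2) a by blast
      \<comment> \<open>The bound closer to \<open>s\<close> works for both sets.\<close>
      consider "le y z" | "le z y" using le_total y z by blast
      then show "\<exists>y\<in>X. less y s \<and> (\<forall>x\<in>X. less y x \<and> le x s \<longrightarrow> x \<in> U \<inter> V)"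
      proof cases
        case 1
        then have "less y x" if "x \<in> X" "less z x" for x
          using that le_less_trans[of y z x] y(1) z(1) by simp
        then show ?thesis using y(3) z by (intro bexI[of _ z]) simp_all
      next
        case 2
        then have "less z x" if "x \<in> X" "less y x" for x
          using that le_less_trans[of z y x] y(1) z(1) by simp
        then show ?thesis using z(3) y by (intro bexI[of _ y]) simp_all
      qed
    next
      fix a assume a: "a \<in> X" "less s a"
      obtain y where y: "y \<in> X" "less s y" "\<forall>x\<in>X. less x y \<and> le s x \<longrightarrow> x \<in> U"
        using hi(1) a by blast
      obtain z where z: "z \<in> X" "less s z" "\<forall>x\<in>X. less x z \<and> le s x \<longrightarrow> x \<in> V"
        using hi(2) a by blast
      consider "le y z" | "le z y" using le_total y z by blast
      then show "\<exists>y\<in>X. less s y \<and> (\<forall>x\<in>X. less x y \<and> le s x \<longrightarrow> x \<in> U \<inter> V)"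
      proof cases
        case 1
        then have "less x z" if "x \<in> X" "less x y" for x
          using that less_le_trans[of x y z] y(1) z(1) by simp
        then show ?thesis using z(3) y by (intro bexI[of _ y]) simp_all
      next
        case 2
        then have "less x y" if "x \<in> X" "less x z" for x
          using that less_le_trans[of x z y] y(1) z(1) by simp
        then show ?thesis using y(3) z by (intro bexI[of _ z]) simp_all
      qed
    qed
  next
    case (UN K)
    then obtain k where "k \<in> K" "s \<in> k" by blast
    from UN.IH[OF this] \<open>k \<in> K\<close> show ?case by (meson UnionI)
  next
    case (Basis W)
    have left: "\<exists>y\<in>X. less y s \<and> (\<forall>x\<in>X. less y x \<and> le x s \<longrightarrow> P x)"
      if "y \<in> X" "less y s" "\<And>x. x \<in> X \<Longrightarrow> less y x \<Longrightarrow> le x s \<Longrightarrow> P x" for y P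
      using that by blast
    have right: "\<exists>y\<in>X. less s y \<and> (\<forall>x\<in>X. less x y \<and> le s x \<longrightarrow> P x)"
      if "y \<in> X" "less s y" "\<And>x. x \<in> X \<Longrightarrow> less x y \<Longrightarrow> le s x \<Longrightarrow> P x" for y P
      using that by blast
    have sX: "s \<in> X" using Basis by blast
    have up: "less p x" if "p \<in> X" "less p s" "x \<in> X" "le s x" for p x
      using that sX less_le_trans[of p s x] by simp
    have down: "less x p" if "p \<in> X" "less s p" "x \<in> X" "le x s" for p x
      using that sX le_less_trans[of x s p] by simp
    consider p q where "p \<in> X" "q \<in> X" "W = {z \<in> X. less p z \<and> less z q}"
      | p where "p \<in> X" "W = {z \<in> X. less p z}"
      | q where "q \<in> X" "W = {z \<in> X. less z q}"
      | "W = X"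
      using Basis(1) by blast
    then show ?case
    proof cases
      case 1
      then have pq: "less p s" "less s q" using Basis(2) by auto
      then show ?thesis using 1 up[OF 1(1) pq(1)] down[OF 1(2) pq(2)]
        by (intro conjI ballI impI left[of p] right[of q]) simp_all
    next
      case 2
      then have "less p s" using Basis(2) by auto
      show ?thesis
      proof (intro conjI ballI impI)
        \<comment> \<open>A ray puts no restriction on its unbounded side, so the point
          \<open>b\<close> that is known to exist there can itself be the bound.\<close>
        fix b assume "b \<in> X" "less s b"
        then show "\<exists>y\<in>X. less s y \<and> (\<forall>x\<in>X. less x y \<and> le s x \<longrightarrow> x \<in> W)"
          using 2 up[OF 2(1) \<open>less p s\<close>] by (intro right[of b]) simp_all
      qed (use 2 \<open>less p s\<close> in \<open>intro left[of p], simp_all\<close>)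
    next
      case 3
      then have "less s q" using Basis(2) by auto
      show ?thesis
      proof (intro conjI ballI impI)
        fix b assume "b \<in> X" "less b s"
        then show "\<exists>y\<in>X. less y s \<and> (\<forall>x\<in>X. less y x \<and> le x s \<longrightarrow> x \<in> W)"
          using 3 down[OF 3(1) \<open>less s q\<close>] by (intro left[of b]) simp_all
      qed (use 3 \<open>less s q\<close> in \<open>intro right[of q], simp_all\<close>)
    next
      case 4
      then show ?thesis by blast
    qed
  qed
qed

text \<open>Let \<open>s\<close> be the supremum of the points up to which everything from
  \<open>a\<close> on lies in \<open>U\<close>. If \<open>s\<close> is in \<open>U\<close>, openness
  and density push the stretch beyond \<open>s\<close>; if \<open>s\<close> is in \<open>V\<close>,
  openness puts points of the stretch into \<open>V\<close>.\<close>

lemma no_order_separation: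
  assumes complete: "\<And>S. S \<subseteq> X \<Longrightarrow> \<exists>s\<in>X. (\<forall>x\<in>S. le x s) \<and> (\<forall>u\<in>X. (\<forall>x\<in>S. le x u) \<longrightarrow> le s u)"
    and U: "openin (order_topology_on X le) U" and V: "openin (order_topology_on X le) V"
    and UV: "X \<subseteq> U \<union> V" "U \<inter> V = {}" "U \<subseteq> X" "V \<subseteq> X"
    and ab: "a \<in> U" "b \<in> V" "less a b"
  shows False
proof -
  have abX: "a \<in> X" "b \<in> X" using UV ab by auto
  \<comment> \<open>Asking for the whole stretch from \<open>a\<close> to \<open>x\<close>, not just
    for \<open>x\<close>, is what yields \<open>below\<close>: a point under \<open>s\<close> is no
    upper bound of \<open>S\<close>, so it lies under a member of \<open>S\<close>.\<close>
  define S where "S = {x \<in> X. le a x \<and> le x b \<and> (\<forall>y\<in>X. le a y \<and> le y x \<longrightarrow> y \<in> U)}"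
  have SX: "S \<subseteq> X" by (auto simp: S_def)
  obtain s where s: "s \<in> X" "\<And>x. x \<in> S \<Longrightarrow> le x s" "\<And>u. u \<in> X \<Longrightarrow> (\<forall>x\<in>S. le x u) \<Longrightarrow> le s u"
    using complete[OF SX] by blast
  have aS: "a \<in> S"
    using ab abX le_refl le_antisym unfolding S_def less_def by blast
  have as: "le a s" using s aS by blast
  have sb: "le s b" using s(3)[of b] abX by (auto simp: S_def)
  have below: "y \<in> U" if y: "y \<in> X" "le a y" "less y s" for y
  proof -
    obtain x where x: "x \<in> S" "\<not> le x y" using s(3)[of y] y less_iff_not_le s(1) by blast
    then have "le y x" using le_total y SX by blast
    then show ?thesis using x y by (auto simp: S_def)
  qed
  consider "s \<in> U" | "s \<in> V" using UV s by blast
  then show False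
  proof cases
    case 1
    then have "s \<noteq> b" using ab UV by blast
    then have sb': "less s b" using sb by (simp add: less_def)
    obtain y where y: "y \<in> X" "less s y" "\<And>x. x \<in> X \<Longrightarrow> less x y \<Longrightarrow> le s x \<Longrightarrow> x \<in> U"
      using openin_order_topology_nbhd[OF U 1] sb' abX by blast
    \<comment> \<open>\<open>m\<close> is the smaller of \<open>y\<close> and \<open>b\<close>: a
      point between \<open>s\<close> and \<open>m\<close> stays in the neighbourhood and does not
      pass \<open>b\<close>.\<close>
    obtain m where m: "m \<in> X" "less s m" "le m y" "le m b"
      using y(1,2) sb' abX le_total le_refl by metis
    obtain z where z: "z \<in> X" "less s z" "less z m" using less_dense[OF s(1) m(1,2)] by blast
    have "z \<in> S"
      unfolding S_def
    proof (intro CollectI conjI ballI impI)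
      show "le a z" using as z s abX le_trans unfolding less_def by blast
      show "le z b" using z m abX le_trans unfolding less_def by blast
      fix x assume x: "x \<in> X" "le a x \<and> le x z"
      then have "less x m" using z m le_less_trans by blast
      then have "less x y" using x y m less_le_trans by blast
      then show "x \<in> U" using x y(3) below le_total less_iff_not_le s(1) by blast
    qed (rule z)
    then show False using s z less_iff_not_le by blast
  next
    case 2
    then have "s \<noteq> a" using ab UV by blast
    then have "less a s" using as by (simp add: less_def)
    then obtain y where y: "y \<in> X" "less y s" "\<And>x. x \<in> X \<Longrightarrow> less y x \<Longrightarrow> le x s \<Longrightarrow> x \<in> V"
      using openin_order_topology_nbhd[OF V 2] abX by blast
    \<comment> \<open>\<open>y\<close> is below the least upper bound, so some member of
      \<open>S\<close> falls between \<open>y\<close> and \<open>s\<close>, and hence into both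
      \<open>U\<close> and \<open>V\<close>.\<close>
    obtain x where x: "x \<in> S" "\<not> le x y" using s(3)[of y] y less_iff_not_le s(1) by blast
    then have xX: "x \<in> X" "x \<in> U" using le_refl by (auto simp: S_def)
    then have "x \<in> V" using x y s less_iff_not_le by blast
    then show False using xX UV by blast
  qed
qed

lemma connected_space_order_topology:
  assumes complete: "\<And>S. S \<subseteq> X \<Longrightarrow> \<exists>s\<in>X. (\<forall>x\<in>S. le x s) \<and> (\<forall>u\<in>X. (\<forall>x\<in>S. le x u) \<longrightarrow> le s u)"
  shows "connected_space (order_topology_on X le)"
  unfolding connected_space_def topspace_order_topology_on
proof (intro notI, elim exE conjE)
  fix U V
  assume U: "openin (order_topology_on X le) U" and V: "openin (order_topology_on X le) V"
    and UV: "X \<subseteq> U \<union> V" "U \<inter> V = {}" "U \<noteq> {}" "V \<noteq> {}"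
  have sub: "U \<subseteq> X" "V \<subseteq> X"
    using openin_subset[OF U] openin_subset[OF V] by (auto simp: topspace_order_topology_on)
  obtain a b where ab: "a \<in> U" "b \<in> V" using UV by blast
  then consider "less a b" | "less b a" using sub UV le_total unfolding less_def by blast
  then show False
  proof cases
    case 1
    then show False using no_order_separation[OF complete U V] UV sub ab by blast
  next
    case 2
    then show False using no_order_separation[OF complete V U] UV sub ab by blast
  qed
qed


section \<open>Dedekind cuts of a dense linear order\<close>

definition open_initial :: "'c set \<Rightarrow> bool" where
  "open_initial A \<longleftrightarrow> A \<subseteq> X \<and> (\<forall>a\<in>A. \<forall>q\<in>X. le q a \<longrightarrow> q \<in> A) \<and> (\<forall>a\<in>A. \<exists>a'\<in>A. less a a')"

lemma open_initialD: "open_initial A \<Longrightarrow> a \<in> A \<Longrightarrow> q \<in> X \<Longrightarrow> le q a \<Longrightarrow> q \<in> A"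
  unfolding open_initial_def by simp

text \<open>This is the complement of \<open>A\<close> with its least element removed, should there
  be one. That element is the single point which a cut may leave out.\<close>

definition cut_above :: "'c set \<Rightarrow> 'c set" where
  "cut_above A = {q \<in> X. \<exists>v\<in>X - A. less v q}"

text \<open>A maximum of \<open>A\<close> would be its supremum, and a minimum of \<open>B\<close>
  its infimum, so neither exists. For the second claim, if \<open>v < q\<close> both lie outside
  \<open>A\<close> and \<open>q\<close> is not in \<open>B\<close>, then neither is
  \<open>v\<close>, and two points would be missing from the cut.\<close>

lemma dedekind_cut_imp_open_initial:
  assumes "dedekind_cut X le (A, B)"
  shows "open_initial A" "B = cut_above A"
proof -
  have sub: "A \<subseteq> X" "B \<subseteq> X"
    and ini': "\<forall>a\<in>A. \<forall>q\<in>X. le q a \<longrightarrow> q \<in> A"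
    and fin': "\<forall>b\<in>B. \<forall>q\<in>X. le b q \<longrightarrow> q \<in> B"
    and gap': "\<forall>p\<in>X - (A \<union> B). \<forall>q\<in>X - (A \<union> B). p = q"
    and inf': "\<forall>m. is_inf_in X le B m \<longrightarrow> m \<notin> B"
    and sup': "\<forall>m. is_sup_in X le A m \<longrightarrow> m \<notin> A"
    and disj: "A \<inter> B = {}"
    using assms unfolding dedekind_cut_def split_conv by - (elim conjE, assumption)+
  have ini: "q \<in> A" if "a \<in> A" "q \<in> X" "le q a" for a q using ini' that by simp
  have fin: "q \<in> B" if "b \<in> B" "q \<in> X" "le b q" for b q using fin' that by simp
  have gap: "p = q" if "p \<in> X - (A \<union> B)" "q \<in> X - (A \<union> B)" for p q using gap' that by simp
  have inf: "m \<notin> B" if "is_inf_in X le B m" for m using inf' that by simp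
  have sup: "m \<notin> A" if "is_sup_in X le A m" for m using sup' that by simp
  have "\<exists>a'\<in>A. less a a'" if a: "a \<in> A" for a
  proof (rule ccontr)
    assume "\<not> ?thesis"
    then have "\<forall>x\<in>A. le x a" using a sub less_iff_not_le by blast
    then have "is_sup_in X le A a" using a sub by (auto simp: is_sup_in_def is_inf_in_def)
    then show False using sup a by blast
  qed
  then show "open_initial A" unfolding open_initial_def using sub ini by blast
  have B_gt: "\<exists>v\<in>X - A. less v b" if b: "b \<in> B" for b
  proof (rule ccontr)
    assume "\<not> ?thesis"
    then have "\<forall>x\<in>B. le b x" using b sub disj less_iff_not_le by blast
    then have "is_inf_in X le B b" using b sub by (auto simp: is_inf_in_def)
    then show False using inf b by blast
  qed
  have gt_B: "q \<in> B" if q: "q \<in> X" "v \<in> X" "v \<notin> A" "less v q" for q v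
  proof (rule ccontr)
    assume "q \<notin> B"
    moreover have "q \<notin> A" using ini q unfolding less_def by blast
    moreover have "v \<notin> B" using fin q \<open>q \<notin> B\<close> unfolding less_def by blast
    ultimately show False using gap[of v q] q unfolding less_def by blast
  qed
  show "B = cut_above A"
    unfolding cut_above_def
  proof (intro equalityI subsetI CollectI conjI)
    show "b \<in> X" if "b \<in> B" for b using that sub(2) by blast
    show "q \<in> B" if "q \<in> {q \<in> X. \<exists>v\<in>X - A. less v q}" for q using that gt_B by blast
  qed (rule B_gt)
qed

lemma open_initial_imp_dedekind_cut:
  assumes "open_initial A"
  shows "dedekind_cut X le (A, cut_above A)"
proof -
  have sub: "A \<subseteq> X" and ini: "\<And>a q. a \<in> A \<Longrightarrow> q \<in> X \<Longrightarrow> le q a \<Longrightarrow> q \<in> A"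
    and nomax: "\<And>a. a \<in> A \<Longrightarrow> \<exists>a'\<in>A. less a a'"
    using assms unfolding open_initial_def by blast+
  have below: "less a v" if "a \<in> A" "v \<in> X - A" for a v
    using that ini sub less_iff_not_le by blast
  have sep: "less a b" if ab: "a \<in> A" "b \<in> cut_above A" for a b
  proof -
    obtain v where v: "v \<in> X - A" "less v b" "b \<in> X" using ab unfolding cut_above_def by blast
    then show ?thesis using ab below[of a v] sub less_trans[of a v b] by blast
  qed
  have gap: "p = q" if "p \<in> X - (A \<union> cut_above A)" "q \<in> X - (A \<union> cut_above A)" for p q
  proof (rule ccontr)
    assume "p \<noteq> q"
    then have "less p q \<or> less q p" using that le_total[of p q] unfolding less_def by blast
    then show False using that unfolding cut_above_def by blast
  qed
  have inf: "m \<notin> cut_above A" if "is_inf_in X le (cut_above A) m" for m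
  proof
    assume "m \<in> cut_above A"
    then obtain v where v: "m \<in> X" "v \<in> X - A" "less v m" unfolding cut_above_def by blast
    \<comment> \<open>A point strictly between \<open>v\<close> and \<open>m\<close> still belongs
      to \<open>cut_above A\<close>, so \<open>m\<close> is not a lower bound of it.\<close>
    then obtain w where w: "w \<in> X" "less v w" "less w m" using less_dense[of v m] by blast
    then have "w \<in> cut_above A" using v unfolding cut_above_def by blast
    then have "le m w" using that unfolding is_inf_in_def by blast
    then show False using w v(1) less_iff_not_le by blast
  qed
  have sup: "m \<notin> A" if "is_sup_in X le A m" for m
  proof
    assume "m \<in> A"
    then obtain a where a: "a \<in> A" "less m a" using nomax by blast
    then have "le a m" using that unfolding is_sup_in_def is_inf_in_def by blast
    then show False using a sub \<open>m \<in> A\<close> less_iff_not_le by blast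
  qed
  have fin: "q \<in> cut_above A" if bq: "b \<in> cut_above A" "q \<in> X" "le b q" for b q
  proof -
    obtain v where v: "v \<in> X - A" "less v b" "b \<in> X" using bq unfolding cut_above_def by blast
    then have "less v q" using bq less_le_trans[of v b q] by blast
    then show ?thesis using v bq(2) unfolding cut_above_def by blast
  qed
  show ?thesis
    unfolding dedekind_cut_def split_conv
  proof (intro conjI)
    show "A \<inter> cut_above A = {}" using sep unfolding less_def by blast
    show "\<forall>a\<in>A. \<forall>b\<in>cut_above A. le a b \<and> a \<noteq> b" using sep unfolding less_def by blast
    show "cut_above A \<subseteq> X" unfolding cut_above_def by blast
    show "A \<subseteq> X" by (rule sub)
    show "\<forall>a\<in>A. \<forall>q\<in>X. le q a \<longrightarrow> q \<in> A" using ini by simp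
    show "\<forall>b\<in>cut_above A. \<forall>q\<in>X. le b q \<longrightarrow> q \<in> cut_above A" using fin by simp
    show "\<forall>p\<in>X - (A \<union> cut_above A). \<forall>q\<in>X - (A \<union> cut_above A). p = q"
      by (intro ballI gap)
    show "\<forall>m. is_inf_in X le (cut_above A) m \<longrightarrow> m \<notin> cut_above A" using inf by simp
    show "\<forall>m. is_sup_in X le A m \<longrightarrow> m \<notin> A" using sup by simp
  qed
qed

lemma dedekind_cut_iff:
  "dedekind_cut X le C \<longleftrightarrow> open_initial (fst C) \<and> snd C = cut_above (fst C)"
proof (cases C)
  case (Pair A B)
  show ?thesis
    unfolding Pair fst_conv snd_conv
    using dedekind_cut_imp_open_initial open_initial_imp_dedekind_cut by blast
qed

section \<open>The ordered set of cuts\<close>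

lemma open_initial_total:
  assumes "open_initial A" "open_initial B"
  shows "A \<subseteq> B \<or> B \<subseteq> A"
proof (rule ccontr)
  assume "\<not> ?thesis"
  then obtain a b where ab: "a \<in> A" "a \<notin> B" "b \<in> B" "b \<notin> A" by blast
  then have X: "a \<in> X" "b \<in> X" using assms unfolding open_initial_def by blast+
  have "\<not> le b a" using open_initialD[OF assms(1)] ab X by blast
  moreover have "\<not> le a b" using open_initialD[OF assms(2)] ab X by blast
  ultimately show False using le_total[OF X] by simp
qed

lemma open_initial_less:
  assumes q: "q \<in> X"
  shows "open_initial {x \<in> X. less x q}"
  unfolding open_initial_def
proof (intro conjI ballI impI)
  fix a assume a: "a \<in> {x \<in> X. less x q}"
  show "\<exists>a'\<in>{x \<in> X. less x q}. less a a'" using less_dense[of a q] a q by auto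
  fix x assume "x \<in> X" "le x a"
  then show "x \<in> {x \<in> X. less x q}" using le_less_trans[of x a q] a q by simp
qed simp

lemma open_initial_Union: "(\<And>A. A \<in> \<A> \<Longrightarrow> open_initial A) \<Longrightarrow> open_initial (\<Union>\<A>)"
  unfolding open_initial_def by blast

lemma dense_order_on_cuts: "dense_order_on {C. dedekind_cut X le C} cut_le"
proof
  fix C D :: "'c set \<times> 'c set"
  assume C: "C \<in> {C. dedekind_cut X le C}" and D: "D \<in> {C. dedekind_cut X le C}"
  show "C = D" if "cut_le C D" "cut_le D C"
    using that C D by (auto simp: dedekind_cut_iff cut_le_def prod_eq_iff)
  show "cut_le C D \<or> cut_le D C"
    using C D open_initial_total by (auto simp: dedekind_cut_iff cut_le_def)
  assume CD: "cut_le C D" "C \<noteq> D"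
  then have "fst C \<subseteq> fst D" "fst C \<noteq> fst D"
    using C D by (auto simp: dedekind_cut_iff cut_le_def prod_eq_iff)
  then obtain q where q: "q \<in> fst D" "q \<notin> fst C" by blast
  have oC: "open_initial (fst C)" and oD: "open_initial (fst D)"
    using C D by (auto simp: dedekind_cut_iff)
  \<comment> \<open>The ray below \<open>q\<close> could coincide with \<open>fst C\<close>. Moving
    up to some \<open>r\<close> inside \<open>fst D\<close>, which has no maximum, gives a ray that
    contains \<open>q\<close> and misses \<open>r\<close>.\<close>
  then obtain r where r: "r \<in> fst D" "less q r" using q unfolding open_initial_def by blast
  have X: "q \<in> X" "r \<in> X" "fst C \<subseteq> X" using q r oD oC unfolding open_initial_def by blast+
  define A where "A = {x \<in> X. less x r}"
  have "open_initial A" unfolding A_def by (rule open_initial_less[OF X(2)])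
  then have cut: "dedekind_cut X le (A, cut_above A)" by (rule open_initial_imp_dedekind_cut)
  have "x \<in> A" if x: "x \<in> fst C" for x
  proof -
    have "x \<in> X" using x X by blast
    moreover have "\<not> le q x" using x q(2) X(1) open_initialD[OF oC] by blast
    ultimately have "less x q" using less_iff_not_le X(1) by simp
    then show ?thesis using \<open>x \<in> X\<close> X r(2) less_trans[of x q r] unfolding A_def by simp
  qed
  moreover have "q \<in> A" using X r by (simp add: A_def)
  moreover have "r \<notin> A" by (simp add: A_def less_def)
  moreover have "A \<subseteq> fst D" using oD r(1) by (auto simp: A_def open_initial_def less_def)
  ultimately show "\<exists>E\<in>{C. dedekind_cut X le C}. cut_le C E \<and> C \<noteq> E \<and> cut_le E D \<and> E \<noteq> D"
    using cut q r(1) by (intro bexI[of _ "(A, cut_above A)"]) (auto simp: cut_le_def)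
qed (auto simp: cut_le_def)

text \<open>Completeness comes from unions of lower halves, which again have no maximum. The empty
  family is included and yields the cut with empty lower half.\<close>

lemma connected_space_cuts:
  "connected_space (order_topology_on {C. dedekind_cut X le C} cut_le)"
proof (rule dense_order_on.connected_space_order_topology[OF dense_order_on_cuts])
  fix S assume S: "S \<subseteq> {C. dedekind_cut X le C}"
  let ?A = "\<Union>(fst ` S)"
  have "open_initial ?A" using S by (intro open_initial_Union) (auto simp: dedekind_cut_iff)
  then have "dedekind_cut X le (?A, cut_above ?A)" by (rule open_initial_imp_dedekind_cut)
  then show "\<exists>s\<in>{C. dedekind_cut X le C}. (\<forall>x\<in>S. cut_le x s) \<and>
      (\<forall>u\<in>{C. dedekind_cut X le C}. (\<forall>x\<in>S. cut_le x u) \<longrightarrow> cut_le s u)"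
    by (intro bexI[of _ "(?A, cut_above ?A)"]) (auto simp: cut_le_def)
qed

end


section \<open>Fractions over a ring with a positive cone\<close>

text \<open>Trichotomy is required on \<open>S\<close> only. Absence of zero divisors is not
  assumed; it is a consequence of the cone axioms.\<close>

locale positive_cone =
  fixes S :: "'r::comm_ring_1 set" and pos :: "'r \<Rightarrow> bool"
  assumes add_closed: "p \<in> S \<Longrightarrow> q \<in> S \<Longrightarrow> p + q \<in> S"
    and mult_closed: "p \<in> S \<Longrightarrow> q \<in> S \<Longrightarrow> p * q \<in> S"
    and uminus_closed: "p \<in> S \<Longrightarrow> - p \<in> S"
    and pos_add: "p \<in> S \<Longrightarrow> q \<in> S \<Longrightarrow> pos p \<Longrightarrow> pos q \<Longrightarrow> pos (p + q)"
    and pos_mult: "p \<in> S \<Longrightarrow> q \<in> S \<Longrightarrow> pos p \<Longrightarrow> pos q \<Longrightarrow> pos (p * q)"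
    and trichotomy: "p \<in> S \<Longrightarrow> p = 0 \<or> pos p \<or> pos (- p)"
    and not_pos_0: "\<not> pos 0"
begin

lemma diff_closed: "p \<in> S \<Longrightarrow> q \<in> S \<Longrightarrow> p - q \<in> S"
  using add_closed[of p "- q"] uminus_closed[of q] by simp

lemmas closed = add_closed mult_closed uminus_closed diff_closed

definition nonneg :: "'r \<Rightarrow> bool" where
  "nonneg p \<longleftrightarrow> p = 0 \<or> pos p"

lemma nonneg_add: "p \<in> S \<Longrightarrow> q \<in> S \<Longrightarrow> nonneg p \<Longrightarrow> nonneg q \<Longrightarrow> nonneg (p + q)"
  unfolding nonneg_def using pos_add by auto

lemma nonneg_total: "p \<in> S \<Longrightarrow> nonneg p \<or> nonneg (- p)"
  unfolding nonneg_def using trichotomy by blast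

lemma nonneg_antisym: "p \<in> S \<Longrightarrow> nonneg p \<Longrightarrow> nonneg (- p) \<Longrightarrow> p = 0"
  unfolding nonneg_def using pos_add[of p "- p"] uminus_closed not_pos_0 by auto

lemma pos_square: "p \<in> S \<Longrightarrow> p \<noteq> 0 \<Longrightarrow> pos (p * p)"
  using trichotomy[of p] pos_mult[of p p] pos_mult[of "- p" "- p"] uminus_closed[of p] by auto

text \<open>Together with \<open>nonneg_cancel\<close> this allows squares of denominators to be
  introduced and removed without knowing the signs of the denominators.\<close>

lemma nonneg_mult_square: "p \<in> S \<Longrightarrow> q \<in> S \<Longrightarrow> nonneg p \<Longrightarrow> nonneg (p * (q * q))"
  using pos_mult[of p "q * q"] pos_square[of q] mult_closed[of q q] unfolding nonneg_def
  by (cases "q = 0") auto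

text \<open>Nonzero squares are positive, so \<open>p * q = 0\<close> would make the positive
  element \<open>(p * p) * (q * q)\<close> vanish.\<close>

lemma mult_nonzero:
  assumes "p \<in> S" "q \<in> S" "p \<noteq> 0" "q \<noteq> 0"
  shows "p * q \<noteq> 0"
proof
  assume "p * q = 0"
  then have "(p * p) * (q * q) = 0" by (simp add: algebra_simps)
  moreover have "pos ((p * p) * (q * q))" using assms by (intro pos_mult pos_square closed)
  ultimately show False using not_pos_0 by simp
qed

lemma mult_right_cancel_closed:
  assumes "p \<in> S" "q \<in> S" "r \<in> S" "r \<noteq> 0" "p * r = q * r"
  shows "p = q"
  using mult_nonzero[of "p - q" r] assms closed by (auto simp: algebra_simps)

lemma nonneg_cancel:
  assumes "p \<in> S" "r \<in> S" "pos r" "nonneg (p * r)"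
  shows "nonneg p"
proof (rule ccontr)
  assume "\<not> nonneg p"
  then have "pos (- p)" "p \<noteq> 0" using trichotomy assms unfolding nonneg_def by auto
  then have "pos (- (p * r))" using pos_mult[of "- p" r] assms closed by simp
  then have "p * r = 0" using nonneg_antisym[of "p * r"] assms closed unfolding nonneg_def by simp
  then show False using mult_nonzero[of p r] assms \<open>p \<noteq> 0\<close> not_pos_0 by auto
qed

section \<open>Formal fractions: equivalence, order and density\<close>

definition fractions :: "('r \<times> 'r) set" where
  "fractions = S \<times> (S - {0})"

definition frac_eq :: "'r \<times> 'r \<Rightarrow> 'r \<times> 'r \<Rightarrow> bool" where
  "frac_eq x y \<longleftrightarrow> fst x * snd y = snd x * fst y"

text \<open>Numerator times denominator of the difference \<open>y - x\<close>, with the factors in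
  the order in which \<open>Q_add\<close> and \<open>Q_uminus\<close> produce them.\<close>

definition frac_le :: "'r \<times> 'r \<Rightarrow> 'r \<times> 'r \<Rightarrow> bool" where
  "frac_le x y \<longleftrightarrow> nonneg ((fst y * snd x - snd y * fst x) * (snd y * snd x))"

lemma frac_eq_trans:
  assumes "x \<in> fractions" "y \<in> fractions" "z \<in> fractions" "frac_eq x y" "frac_eq y z"
  shows "frac_eq x z"
proof -
  obtain a b c d e f where xyz: "x = (a, b)" "y = (c, d)" "z = (e, f)"
    by (metis surj_pair)
  have S: "a \<in> S" "b \<in> S" "c \<in> S" "d \<in> S" "e \<in> S" "f \<in> S" "d \<noteq> 0"
    using assms(1-3) by (auto simp: fractions_def xyz)
  have "a * d = b * c" "c * f = d * e" using assms(4,5) by (auto simp: frac_eq_def xyz)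
  then have "(a * d) * f = b * (d * e)" by (simp add: mult.assoc)
  then have "(a * f) * d = (b * e) * d" by (simp add: mult_ac)
  then have "a * f = b * e" using mult_right_cancel_closed[of "a * f" "b * e" d] S closed by blast
  then show ?thesis by (simp add: frac_eq_def xyz)
qed

lemma frac_eq_sym: "frac_eq x y \<Longrightarrow> frac_eq y x"
  unfolding frac_eq_def by (simp add: mult.commute)

lemma frac_le_refl: "frac_le x x"
  unfolding frac_le_def nonneg_def by (simp add: mult.commute)

lemma frac_le_total:
  assumes "x \<in> fractions" "y \<in> fractions"
  shows "frac_le x y \<or> frac_le y x"
proof -
  obtain a b c d where xy: "x = (a, b)" "y = (c, d)" by (metis surj_pair)
  have S: "a \<in> S" "b \<in> S" "c \<in> S" "d \<in> S"
    using assms by (auto simp: fractions_def xy)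
  have "a * d - b * c = - (c * b - d * a)" by (simp add: mult.commute)
  then have "(a * d - b * c) * (b * d) = - ((c * b - d * a) * (d * b))"
    by (simp only: mult_minus_left mult.commute[of b d])
  moreover have "(c * b - d * a) * (d * b) \<in> S" using S by (simp add: closed)
  ultimately show ?thesis
    using nonneg_total by (simp add: frac_le_def xy)
qed

lemma frac_le_antisym:
  assumes "x \<in> fractions" "y \<in> fractions" "frac_le x y" "frac_le y x"
  shows "frac_eq x y"
proof -
  obtain a b c d where xy: "x = (a, b)" "y = (c, d)" by (metis surj_pair)
  have S: "a \<in> S" "b \<in> S" "c \<in> S" "d \<in> S" "b \<noteq> 0" "d \<noteq> 0"
    using assms(1,2) by (auto simp: fractions_def xy)
  have "a * d - b * c = - (c * b - d * a)" by (simp add: mult.commute)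
  then have "(a * d - b * c) * (b * d) = - ((c * b - d * a) * (d * b))"
    by (simp only: mult_minus_left mult.commute[of b d])
  then have "nonneg ((c * b - d * a) * (d * b))" "nonneg (- ((c * b - d * a) * (d * b)))"
    using assms(3,4) by (simp_all add: frac_le_def xy)
  then have "(c * b - d * a) * (d * b) = 0"
    using S by (intro nonneg_antisym closed)
  moreover have "d * b \<noteq> 0" "d * b \<in> S" "c * b - d * a \<in> S"
    using S by (simp_all add: mult_nonzero closed)
  ultimately have "c * b - d * a = 0" using mult_nonzero by blast
  then show ?thesis by (simp add: frac_eq_def xy mult.commute)
qed

lemma frac_le_trans:
  assumes "x \<in> fractions" "y \<in> fractions" "z \<in> fractions" "frac_le x y" "frac_le y z"
  shows "frac_le x z"
proof -
  obtain a b c d e f where xyz: "x = (a, b)" "y = (c, d)" "z = (e, f)"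
    by (metis surj_pair)
  have S: "a \<in> S" "b \<in> S" "c \<in> S" "d \<in> S" "e \<in> S" "f \<in> S" "d \<noteq> 0" "b \<noteq> 0" "f \<noteq> 0"
    using assms(1-3) by (auto simp: fractions_def xyz)
  define u v w where "u = c * b - d * a" and "v = e * d - f * c" and "w = e * b - f * a"
  have uvw: "u \<in> S" "v \<in> S" "w \<in> S" unfolding u_def v_def w_def using S by (simp_all add: closed)
  \<comment> \<open>The identity \<open>z - x = (y - x) + (z - y)\<close>, cleared of
    denominators.\<close>
  have "w * d = u * f + v * b"
    unfolding u_def v_def w_def by (simp add: algebra_simps)
  \<comment> \<open>This factor turns each term into a numerator times its own denominator times a
    square, so the signs of \<open>b\<close>, \<open>d\<close> and \<open>f\<close> do not matter;
    the square \<open>d * d\<close> is cancelled at the end.\<close>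
  then have "(w * d) * (f * b * d) = (u * f + v * b) * (f * b * d)" by simp
  then have "(w * (f * b)) * (d * d) = (u * (d * b)) * (f * f) + (v * (f * d)) * (b * b)"
    by (simp only: distrib_left distrib_right mult_ac)
  moreover have "nonneg (u * (d * b))" "nonneg (v * (f * d))"
    using assms(4,5) by (simp_all add: frac_le_def xyz u_def v_def)
  then have "nonneg ((u * (d * b)) * (f * f) + (v * (f * d)) * (b * b))"
    using S uvw by (intro nonneg_add nonneg_mult_square closed)
  ultimately have "nonneg ((w * (f * b)) * (d * d))" by simp
  then have "nonneg (w * (f * b))"
    by (rule nonneg_cancel[rotated 3]) (use S uvw in \<open>simp_all add: closed pos_square\<close>)
  then show ?thesis by (simp add: frac_le_def xyz w_def)
qed

text \<open>Either \<open>p\<close> or \<open>- p\<close> is positive, and then so is its double.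
  This keeps the denominator of a midpoint away from zero.\<close>

lemma double_nonzero: "p \<in> S \<Longrightarrow> p \<noteq> 0 \<Longrightarrow> p + p \<noteq> 0"
  using trichotomy[of p] pos_add[of p p] pos_add[of "- p" "- p"] uminus_closed[of p] not_pos_0
  by (metis add.inverse_neutral minus_add_distrib)

lemma frac_le_dense:
  assumes "x \<in> fractions" "y \<in> fractions" "frac_le x y" "\<not> frac_eq x y"
  shows "\<exists>z\<in>fractions. frac_le x z \<and> \<not> frac_eq x z \<and> frac_le z y \<and> \<not> frac_eq z y"
proof -
  obtain a b c d where xy: "x = (a, b)" "y = (c, d)" by (metis surj_pair)
  have S: "a \<in> S" "b \<in> S" "c \<in> S" "d \<in> S" "b \<noteq> 0" "d \<noteq> 0"
    using assms(1,2) by (auto simp: fractions_def xy)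
  \<comment> \<open>the midpoint of \<open>x\<close> and \<open>y\<close>\<close>
  define e f where "e = c * b + d * a" and "f = d * b + d * b"
  define u where "u = c * b - d * a"
  have u: "u \<in> S" "u \<noteq> 0" "nonneg (u * (d * b))"
    using assms(3,4) S by (auto simp: frac_eq_def frac_le_def xy u_def mult.commute intro!: closed)
  \<comment> \<open>Both steps, from \<open>x\<close> to the midpoint and from there to
    \<open>y\<close>, have the numerator of \<open>y - x\<close> as a factor. They therefore inherit
    its sign and are nonzero.\<close>
  have diff: "e * b - f * a = u * b" "c * f - d * e = u * d"
    unfolding e_def f_def u_def by (simp_all add: algebra_simps)
  have "e \<in> S" unfolding e_def using S by (intro closed)
  moreover have "f \<in> S" unfolding f_def using S by (intro closed)
  moreover have "f \<noteq> 0" unfolding f_def using S by (intro double_nonzero mult_nonzero closed)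
  ultimately have "(e, f) \<in> fractions" by (simp add: fractions_def)
  moreover have "frac_le x (e, f)"
  proof -
    have "(u * b) * (f * b) = (u * (d * b)) * (b * b) + (u * (d * b)) * (b * b)"
      unfolding f_def by (simp only: distrib_left distrib_right mult_ac)
    moreover have "nonneg \<dots>"
      using u S by (intro nonneg_add nonneg_mult_square closed)
    ultimately show ?thesis by (simp add: frac_le_def xy diff)
  qed
  moreover have "frac_le (e, f) y"
  proof -
    have "(u * d) * (d * f) = (u * (d * b)) * (d * d) + (u * (d * b)) * (d * d)"
      unfolding f_def by (simp only: distrib_left distrib_right mult_ac)
    moreover have "nonneg \<dots>"
      using u S by (intro nonneg_add nonneg_mult_square closed)
    ultimately show ?thesis by (simp add: frac_le_def xy diff)
  qed
  moreover have "u * b \<noteq> 0" "u * d \<noteq> 0" using u S by (simp_all add: mult_nonzero)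
  then have "\<not> frac_eq x (e, f)" "\<not> frac_eq (e, f) y"
    using diff by (auto simp: frac_eq_def xy mult.commute)
  ultimately show ?thesis by (intro bexI[of _ "(e, f)"] conjI)
qed

end


section \<open>Polynomials in omega with integer coefficients\<close>

abbreviation (input) coeff :: "('b \<Rightarrow>\<^sub>0 'c::zero) \<Rightarrow> 'b \<Rightarrow> 'c" where
  "coeff \<equiv> Poly_Mapping.lookup"

abbreviation (input) supp :: "('b \<Rightarrow>\<^sub>0 'c::zero) \<Rightarrow> 'b set" where
  "supp \<equiv> Poly_Mapping.keys"

lemma poly_mapping_single_induct [case_names zero add]:
  assumes "P 0" and "\<And>f k v. P f \<Longrightarrow> P (f + Poly_Mapping.single k v)"
  shows "P (f :: 'b \<Rightarrow>\<^sub>0 'c::comm_monoid_add)"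
proof (induction f rule: update_induct)
  case (update f a b)
  have "Poly_Mapping.update a b f = f + Poly_Mapping.single a b"
    using update(1) by (intro poly_mapping_eqI)
      (auto simp: lookup_update lookup_add lookup_single when_def in_keys_iff)
  then show ?case using assms(2)[OF update(3)] by simp
qed (rule assms(1))

definition int_poly :: "('b \<Rightarrow>\<^sub>0 nat) \<Rightarrow> ('b \<Rightarrow>\<^sub>0 int)" where
  "int_poly = Poly_Mapping.map int"

lemma coeff_int_poly [simp]: "coeff (int_poly p) k = int (coeff p k)"
  unfolding int_poly_def by (simp add: map.rep_eq when_def)

lemma supp_int_poly [simp]: "supp (int_poly p) = supp p"
  by (auto simp: in_keys_iff)

lemma int_poly_eq_iff: "int_poly p = int_poly q \<longleftrightarrow> p = q"
  by (metis coeff_int_poly of_nat_eq_iff poly_mapping_eqI)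

lemma int_poly_0 [simp]: "int_poly 0 = 0"
  by (rule poly_mapping_eqI) simp

lemma int_poly_add [simp]: "int_poly (p + q) = int_poly p + int_poly q"
  by (rule poly_mapping_eqI) (simp add: lookup_add)

lemma int_poly_single [simp]:
  "int_poly (Poly_Mapping.single k v) = Poly_Mapping.single k (int v)"
  by (rule poly_mapping_eqI) (simp add: lookup_single when_def)

text \<open>Both sides are additive in each factor, so it suffices to compare them on monomials;
  hence two nested inductions, one per factor.\<close>

lemma int_poly_mult [simp]:
  fixes p q :: "'b::comm_monoid_add \<Rightarrow>\<^sub>0 nat"
  shows "int_poly (p * q) = int_poly p * int_poly q"
proof (induction p rule: poly_mapping_single_induct)
  case (add p k v)
  have "int_poly (Poly_Mapping.single k v * q) = Poly_Mapping.single k (int v) * int_poly q"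
    by (induction q rule: poly_mapping_single_induct)
      (simp_all add: distrib_left mult_single)
  then show ?case using add by (simp add: distrib_right)
qed simp

text \<open>Split the coefficients into positive and negative parts. The bounds on the supports keep
  both parts in \<open>N_set \<alpha>\<close> when \<open>p\<close> is in
  \<open>polys\<close>.\<close>

lemma int_poly_diff_surj:
  obtains a b where "int_poly a - int_poly b = p" "supp a \<subseteq> supp p" "supp b \<subseteq> supp p"
proof
  let ?a = "Poly_Mapping.map nat p" and ?b = "Poly_Mapping.map (\<lambda>c. nat (- c)) p"
  show "int_poly ?a - int_poly ?b = p"
    by (rule poly_mapping_eqI) (simp add: lookup_minus map.rep_eq when_def)
  show "supp ?a \<subseteq> supp p" "supp ?b \<subseteq> supp p"
    by (auto simp: in_keys_iff map.rep_eq when_def)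
qed

locale omega_polynomials =
  fixes \<alpha> :: "'a rel"
  assumes Well_order: "Well_order \<alpha>"
begin

section \<open>Exponents: the natural sum and the order\<close>

abbreviation T :: "('a \<Rightarrow>\<^sub>0 nat) rel" where
  "T \<equiv> omega_pow \<alpha>"

lemma Well_order_T: "Well_order T"
  by (rule Well_order_omega_pow[OF Well_order])

lemma T_trans: "(x, y) \<in> T \<Longrightarrow> (y, z) \<in> T \<Longrightarrow> (x, z) \<in> T"
  using wo_rel.TRANS[of T] Well_order_T by (auto simp: wo_rel_def dest: transD)

lemma T_antisym: "(x, y) \<in> T \<Longrightarrow> (y, x) \<in> T \<Longrightarrow> x = y"
  using wo_rel.ANTISYM[of T] Well_order_T by (auto simp: wo_rel_def dest: antisymD)

lemma T_total: "x \<in> Field T \<Longrightarrow> y \<in> Field T \<Longrightarrow> (x, y) \<in> T \<or> (y, x) \<in> T"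
  using wo_rel.TOTALS[of T] Well_order_T by (auto simp: wo_rel_def)

lemma T_refl: "x \<in> Field T \<Longrightarrow> (x, x) \<in> T"
  using T_total by blast

lemma Field_T_add: "x \<in> Field T \<Longrightarrow> y \<in> Field T \<Longrightarrow> x + y \<in> Field T"
  using keys_add[of x y] by (auto simp: Field_omega_pow)

text \<open>Adding \<open>z\<close> shifts both coefficients equally at every place, so the largest
  place of difference and the direction of the difference there are unchanged.\<close>

lemma T_add_right:
  assumes "(x, y) \<in> T" "z \<in> Field T"
  shows "(x + z, y + z) \<in> T"
proof (cases "x = y")
  case True
  then show ?thesis using Field_T_add[of y z] FieldI2[OF assms(1)] assms(2) T_refl by simp
next
  case False
  then obtain k where k: "coeff x k < coeff y k"
    "\<forall>j. (k, j) \<in> \<alpha> \<and> j \<noteq> k \<longrightarrow> coeff x j = coeff y j"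
    using assms(1) unfolding omega_pow_def by blast
  have "x + z \<in> Field T" "y + z \<in> Field T"
    using Field_T_add FieldI1[OF assms(1)] FieldI2[OF assms(1)] assms(2) by blast+
  then have "supp (x + z) \<subseteq> Field \<alpha>" "supp (y + z) \<subseteq> Field \<alpha>"
    by (simp_all add: Field_omega_pow)
  then show ?thesis
  proof (rule omega_pow_lessI[of _ _ _ k])
    show "coeff (x + z) k < coeff (y + z) k" using k(1) by (simp add: lookup_add)
    show "coeff (x + z) j = coeff (y + z) j" if "(k, j) \<in> \<alpha>" "j \<noteq> k" for j
      using k(2) that by (simp add: lookup_add)
  qed
qed

lemma T_add: "(x, y) \<in> T \<Longrightarrow> (u, v) \<in> T \<Longrightarrow> (x + u, y + v) \<in> T"
  using T_trans[of "x + u" "y + u" "y + v"] T_add_right[of x y u] T_add_right[of u v y]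
  by (simp add: FieldI1 FieldI2 add.commute)

text \<open>Strict monotonicity, in the form needed for products: the sum of two leading exponents
  arises from just one pair of exponents.\<close>

lemma T_add_eq:
  assumes "(x, y) \<in> T" "(u, v) \<in> T" "x + u = y + v"
  shows "x = y" "u = v"
proof -
  have "(y + u, y + v) \<in> T" "(x + u, y + u) \<in> T"
    using T_add_right[of u v y] T_add_right[of x y u] assms(1,2)
    by (simp_all add: FieldI1 FieldI2 add.commute)
  then have "x + u = y + u" using T_antisym assms(3) by metis
  then show "x = y" by simp
  then show "u = v" using assms(3) by simp
qed

section \<open>Leading coefficients and the positive cone\<close>

definition polys :: "(('a \<Rightarrow>\<^sub>0 nat) \<Rightarrow>\<^sub>0 int) set" where
  "polys = {p. supp p \<subseteq> Field T}"

text \<open>Being a relation, it needs no default value: the zero polynomial has no leading exponent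
  and so is not \<open>pos\<close>.\<close>

definition leading :: "(('a \<Rightarrow>\<^sub>0 nat) \<Rightarrow>\<^sub>0 int) \<Rightarrow> ('a \<Rightarrow>\<^sub>0 nat) \<Rightarrow> bool" where
  "leading p k \<longleftrightarrow> k \<in> supp p \<and> (\<forall>j\<in>supp p. (j, k) \<in> T)"

definition pos :: "(('a \<Rightarrow>\<^sub>0 nat) \<Rightarrow>\<^sub>0 int) \<Rightarrow> bool" where
  "pos p \<longleftrightarrow> (\<exists>k. leading p k \<and> coeff p k > 0)"

lemma leading_exists: "p \<in> polys \<Longrightarrow> p \<noteq> 0 \<Longrightarrow> \<exists>k. leading p k"
  using finite_has_max[OF Well_order_T, of "supp p"] unfolding polys_def leading_def by auto

lemma coeff_mult_eq_0:
  assumes "\<And>a b. a \<in> supp p \<Longrightarrow> b \<in> supp q \<Longrightarrow> a + b \<noteq> m"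
  shows "coeff (p * q) m = 0"
proof (rule ccontr)
  assume "coeff (p * q) m \<noteq> 0"
  then have "m \<in> supp (p * q)" by (simp add: in_keys_iff)
  then show False using assms keys_mult[of p q] by blast
qed

lemma coeff_mult_leading:
  assumes "leading p k" "leading q l"
  shows "coeff (p * q) (k + l) = coeff p k * coeff q l"
proof -
  define p' where "p' = p - Poly_Mapping.single k (coeff p k)"
  define q' where "q' = q - Poly_Mapping.single l (coeff q l)"
  have supp: "supp p' = supp p - {k}" "supp q' = supp q - {l}"
    by (auto simp: p'_def q'_def in_keys_iff lookup_minus lookup_single when_def split: if_splits)
  \<comment> \<open>With the leading monomials split off, only their own product reaches the
    exponent \<open>k + l\<close>; the other two summands have coefficient 0 there.\<close>
  have "p * q = Poly_Mapping.single k (coeff p k) * Poly_Mapping.single l (coeff q l)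
      + Poly_Mapping.single k (coeff p k) * q' + p' * q"
    unfolding p'_def q'_def left_diff_distrib right_diff_distrib by simp
  moreover have "coeff (p' * q) (k + l) = 0"
  proof (rule coeff_mult_eq_0)
    fix a b assume "a \<in> supp p'" "b \<in> supp q"
    then have "(a, k) \<in> T" "(b, l) \<in> T" "a \<noteq> k" using assms by (simp_all add: supp leading_def)
    then show "a + b \<noteq> k + l" using T_add_eq(1) by blast
  qed
  moreover have "coeff (Poly_Mapping.single k (coeff p k) * q') (k + l) = 0"
  proof (rule coeff_mult_eq_0)
    fix a b assume "a \<in> supp (Poly_Mapping.single k (coeff p k))" "b \<in> supp q'"
    then have "a = k" "b \<noteq> l" by (simp_all add: supp split: if_splits)
    then show "a + b \<noteq> k + l" by simp
  qed
  ultimately show ?thesis by (simp add: lookup_add mult_single)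
qed

lemma leading_mult:
  assumes "leading p k" "leading q l"
  shows "leading (p * q) (k + l)"
  unfolding leading_def
proof (intro conjI ballI)
  show "k + l \<in> supp (p * q)"
    using coeff_mult_leading[OF assms] assms by (simp add: leading_def in_keys_iff)
  fix j assume "j \<in> supp (p * q)"
  then obtain a b where "a \<in> supp p" "b \<in> supp q" "j = a + b" using keys_mult[of p q] by blast
  then show "(j, k + l) \<in> T" using assms T_add by (simp add: leading_def)
qed

text \<open>Nothing cancels at the larger exponent \<open>l\<close>: there \<open>p\<close> has
  coefficient 0, or a positive one if \<open>k = l\<close>.\<close>

lemma pos_add_aux:
  assumes "leading p k" "coeff p k > 0" "leading q l" "coeff q l > 0" "(k, l) \<in> T"
  shows "pos (p + q)"
proof -
  have "coeff p l \<ge> 0"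
  proof (cases "l \<in> supp p")
    case True
    then have "l = k" using assms(1,5) T_antisym unfolding leading_def by blast
    then show ?thesis using assms(2) by simp
  qed (simp add: in_keys_iff)
  then have pos: "coeff (p + q) l > 0" using assms(4) by (simp add: lookup_add)
  have "(j, l) \<in> T" if "j \<in> supp (p + q)" for j
  proof -
    have "j \<in> supp p \<or> j \<in> supp q" using that keys_add[of p q] by blast
    then have "(j, k) \<in> T \<or> (j, l) \<in> T" using assms(1,3) by (auto simp: leading_def)
    then show ?thesis using T_trans[OF _ assms(5)] by blast
  qed
  moreover have "l \<in> supp (p + q)" using pos by (simp add: in_keys_iff)
  ultimately show ?thesis using pos unfolding pos_def leading_def by blast
qed

lemma polys_mult: "p \<in> polys \<Longrightarrow> q \<in> polys \<Longrightarrow> p * q \<in> polys"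
  unfolding polys_def using keys_mult[of p q] Field_T_add by blast

lemma polys_add: "p \<in> polys \<Longrightarrow> q \<in> polys \<Longrightarrow> p + q \<in> polys"
  unfolding polys_def using keys_add[of p q] by blast

sublocale positive_cone polys pos
proof
  fix p q assume pq: "p \<in> polys" "q \<in> polys"
  show "p + q \<in> polys" "p * q \<in> polys" using pq by (simp_all add: polys_add polys_mult)
  show "pos (p + q)" if pos: "pos p" "pos q"
  proof -
    obtain k l where kl: "leading p k" "coeff p k > 0" "leading q l" "coeff q l > 0"
      using pos unfolding pos_def by blast
    have "k \<in> Field T" "l \<in> Field T"
      using pq kl(1,3) by (auto simp: leading_def polys_def)
    then have "(k, l) \<in> T \<or> (l, k) \<in> T" by (rule T_total)
    then show ?thesis
    proof
      assume "(k, l) \<in> T"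
      then show ?thesis by (rule pos_add_aux[OF kl])
    next
      assume "(l, k) \<in> T"
      then have "pos (q + p)" by (rule pos_add_aux[OF kl(3,4,1,2)])
      then show ?thesis by (simp add: add.commute)
    qed
  qed
  show "pos (p * q)" if pos: "pos p" "pos q"
  proof -
    obtain k l where kl: "leading p k" "coeff p k > 0" "leading q l" "coeff q l > 0"
      using pos unfolding pos_def by blast
    then have "coeff (p * q) (k + l) > 0" using coeff_mult_leading[OF kl(1,3)] by simp
    then show ?thesis unfolding pos_def using leading_mult[OF kl(1,3)] by blast
  qed
next
  fix p assume p: "p \<in> polys"
  show "- p \<in> polys" using p unfolding polys_def by simp
  show "p = 0 \<or> pos p \<or> pos (- p)"
  proof (cases "p = 0")
    case False
    then obtain k where k: "leading p k" using leading_exists p by blast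
    then have "leading (- p) k" by (simp add: leading_def)
    have "coeff p k \<noteq> 0" using k by (simp add: leading_def in_keys_iff)
    then have "coeff p k > 0 \<or> coeff (- p) k > 0" by auto
    then show ?thesis using k \<open>leading (- p) k\<close> unfolding pos_def by blast
  qed simp
next
  show "\<not> pos 0" by (simp add: pos_def leading_def)
qed

end


section \<open>The ordered field of fractions of the Hessenberg semiring\<close>

text \<open>Operations on classes are unions over all representatives. Once every choice gives the
  same class, the union collapses to it, so this is how well-definedness enters.\<close>

lemma UN_pairs_const:
  assumes "X \<noteq> {}" "\<And>a b. (a, b) \<in> X \<Longrightarrow> f a b = C"
  shows "(\<Union>(a, b)\<in>X. f a b) = C"
proof (rule SUP_eq_const[OF assms(1)])
  fix x assume "x \<in> X"
  then show "(case x of (a, b) \<Rightarrow> f a b) = C" using assms(2) by (cases x) simp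
qed

context omega_polynomials
begin

section \<open>The semiring and its differences in terms of polynomials\<close>

lemma N_set_iff: "a \<in> N_set \<alpha> \<longleftrightarrow> int_poly a \<in> polys"
  unfolding N_set_def N_le_def Field_omega_pow[of T] polys_def by simp

lemma N_set_add: "a \<in> N_set \<alpha> \<Longrightarrow> b \<in> N_set \<alpha> \<Longrightarrow> a + b \<in> N_set \<alpha>"
  by (simp add: N_set_iff closed)

lemma N_set_mult: "a \<in> N_set \<alpha> \<Longrightarrow> b \<in> N_set \<alpha> \<Longrightarrow> a * b \<in> N_set \<alpha>"
  by (simp add: N_set_iff closed)

text \<open>The largest place where \<open>x\<close> and \<open>y\<close> differ is the leading
  exponent of their difference, and the comparison at that place is the sign of the leading
  coefficient.\<close>

lemma N_le_iff:
  assumes "x \<in> N_set \<alpha>" "y \<in> N_set \<alpha>"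
  shows "(x, y) \<in> N_le \<alpha> \<longleftrightarrow> nonneg (int_poly y - int_poly x)"
proof -
  let ?d = "int_poly y - int_poly x"
  have supp_d: "j \<in> supp ?d \<longleftrightarrow> coeff x j \<noteq> coeff y j" for j
    by (auto simp: in_keys_iff lookup_minus)
  have "?d \<in> polys" using assms by (simp add: N_set_iff closed)
  then have Field_d: "j \<in> Field T" if "j \<in> supp ?d" for j using that by (auto simp: polys_def)
  have lead: "leading ?d k \<longleftrightarrow> (\<forall>j. (k, j) \<in> T \<and> j \<noteq> k \<longrightarrow> coeff x j = coeff y j)"
    if k: "coeff x k < coeff y k" for k
  proof
    assume "leading ?d k"
    then show "\<forall>j. (k, j) \<in> T \<and> j \<noteq> k \<longrightarrow> coeff x j = coeff y j"
      unfolding leading_def using supp_d T_antisym by blast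
  next
    assume eq: "\<forall>j. (k, j) \<in> T \<and> j \<noteq> k \<longrightarrow> coeff x j = coeff y j"
    have kd: "k \<in> supp ?d" using k by (simp add: supp_d)
    have "(j, k) \<in> T" if j: "j \<in> supp ?d" for j
    proof (rule ccontr)
      assume nT: "(j, k) \<notin> T"
      then have "(k, j) \<in> T" using T_total[OF Field_d[OF j] Field_d[OF kd]] by blast
      then have "j \<noteq> k" using nT by blast
      then show False using eq j \<open>(k, j) \<in> T\<close> supp_d by blast
    qed
    then show "leading ?d k" using kd by (simp add: leading_def)
  qed
  have "pos ?d \<longleftrightarrow> (\<exists>k. coeff x k < coeff y k \<and>
      (\<forall>j. (k, j) \<in> T \<and> j \<noteq> k \<longrightarrow> coeff x j = coeff y j))"
  proof -
    have "coeff ?d k > 0 \<longleftrightarrow> coeff x k < coeff y k" for k by (simp add: lookup_minus)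
    then show ?thesis unfolding pos_def using lead by blast
  qed
  moreover have "?d = 0 \<longleftrightarrow> x = y" by (auto simp: int_poly_eq_iff)
  moreover have "supp x \<subseteq> Field T" "supp y \<subseteq> Field T"
    using assms by (simp_all add: N_set_iff polys_def)
  ultimately show ?thesis
    unfolding nonneg_def N_le_def omega_pow_def[of T] by simp
qed

text \<open>A class is named by the common difference of its pairs instead of by a representative,
  so equality of classes becomes equality of polynomials.\<close>

definition Z_of :: "(('a \<Rightarrow>\<^sub>0 nat) \<Rightarrow>\<^sub>0 int) \<Rightarrow> 'a Z_ord" where
  "Z_of p = {(a, b). a \<in> N_set \<alpha> \<and> b \<in> N_set \<alpha> \<and> int_poly a - int_poly b = p}"

lemma Z_of_iff:
  "(a, b) \<in> Z_of p \<longleftrightarrow> a \<in> N_set \<alpha> \<and> b \<in> N_set \<alpha> \<and> int_poly a - int_poly b = p"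
  by (simp add: Z_of_def)

lemma Z_class_eq:
  assumes "a \<in> N_set \<alpha>" "b \<in> N_set \<alpha>"
  shows "Z_class \<alpha> a b = Z_of (int_poly a - int_poly b)"
proof -
  have "a + d = b + c \<longleftrightarrow> int_poly c - int_poly d = int_poly a - int_poly b" for c d
  proof -
    have "a + d = b + c \<longleftrightarrow> int_poly a + int_poly d = int_poly b + int_poly c"
      by (simp flip: int_poly_add add: int_poly_eq_iff)
    then show ?thesis by (auto simp: algebra_simps)
  qed
  then show ?thesis using assms by (auto simp: Z_class_def Z_rel_def Z_of_def)
qed

lemma Z_of_nonempty:
  assumes "p \<in> polys"
  shows "Z_of p \<noteq> {}"
proof -
  obtain a b where ab: "int_poly a - int_poly b = p" "supp a \<subseteq> supp p" "supp b \<subseteq> supp p"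
    by (rule int_poly_diff_surj)
  then have "(a, b) \<in> Z_of p"
    using assms by (auto simp: Z_of_iff N_set_iff polys_def)
  then show ?thesis by blast
qed

lemma Z_of_eq_iff: "p \<in> polys \<Longrightarrow> Z_of p = Z_of q \<longleftrightarrow> p = q"
  using Z_of_nonempty[of p] by (auto simp: Z_of_def)

lemma Z_set_eq: "Z_set \<alpha> = Z_of ` polys"
proof
  show "Z_set \<alpha> \<subseteq> Z_of ` polys"
  proof
    fix X assume "X \<in> Z_set \<alpha>"
    then obtain a b where ab: "a \<in> N_set \<alpha>" "b \<in> N_set \<alpha>" "X = Z_class \<alpha> a b"
      unfolding Z_set_def Z_class_def by (auto elim!: quotientE)
    then show "X \<in> Z_of ` polys"
      using Z_class_eq[of a b] by (simp add: N_set_iff closed)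
  qed
  show "Z_of ` polys \<subseteq> Z_set \<alpha>"
  proof
    fix X assume "X \<in> Z_of ` polys"
    then obtain p where p: "p \<in> polys" "X = Z_of p" by blast
    then obtain a b where ab: "(a, b) \<in> Z_of p" using Z_of_nonempty by fast
    then have "Z_class \<alpha> a b = X" using Z_class_eq[of a b] p by (simp add: Z_of_iff)
    then show "X \<in> Z_set \<alpha>"
      using ab unfolding Z_set_def Z_class_def by (auto simp: Z_of_iff intro: quotientI)
  qed
qed

lemma Z_zero_eq: "Z_zero \<alpha> = Z_of 0"
  using Z_class_eq[of 0 0] by (simp add: Z_zero_def N_set_iff polys_def)

lemma Z_add_eq:
  assumes "p \<in> polys" "q \<in> polys"
  shows "Z_add \<alpha> (Z_of p) (Z_of q) = Z_of (p + q)"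
  unfolding Z_add_def
proof (intro UN_pairs_const Z_of_nonempty assms)
  fix a b c d assume "(a, b) \<in> Z_of p" "(c, d) \<in> Z_of q"
  then have N: "a \<in> N_set \<alpha>" "b \<in> N_set \<alpha>" "c \<in> N_set \<alpha>" "d \<in> N_set \<alpha>"
    and pq: "p = int_poly a - int_poly b" "q = int_poly c - int_poly d" by (auto simp: Z_of_iff)
  have "int_poly (a + c) - int_poly (b + d) = p + q"
    unfolding pq int_poly_add by (rule add_diff_add)
  then show "Z_class \<alpha> (a + c) (b + d) = Z_of (p + q)"
    using Z_class_eq[of "a + c" "b + d"] N by (simp add: N_set_add)
qed

lemma Z_uminus_eq:
  assumes "p \<in> polys"
  shows "Z_uminus \<alpha> (Z_of p) = Z_of (- p)"
  unfolding Z_uminus_def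
proof (intro UN_pairs_const Z_of_nonempty assms)
  fix a b assume "(a, b) \<in> Z_of p"
  then have "a \<in> N_set \<alpha>" "b \<in> N_set \<alpha>" "- p = int_poly b - int_poly a" by (auto simp: Z_of_iff)
  then show "Z_class \<alpha> b a = Z_of (- p)" using Z_class_eq[of b a] by simp
qed

lemma Z_mult_eq:
  assumes "p \<in> polys" "q \<in> polys"
  shows "Z_mult \<alpha> (Z_of p) (Z_of q) = Z_of (p * q)"
  unfolding Z_mult_def
proof (intro UN_pairs_const Z_of_nonempty assms)
  fix a b c d assume "(a, b) \<in> Z_of p" "(c, d) \<in> Z_of q"
  then have N: "a \<in> N_set \<alpha>" "b \<in> N_set \<alpha>" "c \<in> N_set \<alpha>" "d \<in> N_set \<alpha>"
    and pq: "p = int_poly a - int_poly b" "q = int_poly c - int_poly d" by (auto simp: Z_of_iff)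
  have "int_poly (a * c + b * d) - int_poly (a * d + b * c) = p * q"
    unfolding pq by (simp add: left_diff_distrib right_diff_distrib)
  then show "Z_class \<alpha> (a * c + b * d) (a * d + b * c) = Z_of (p * q)"
    using Z_class_eq[of "a * c + b * d" "a * d + b * c"] N by (simp add: N_set_add N_set_mult)
qed

lemma Z_le_iff:
  assumes "p \<in> polys" "q \<in> polys"
  shows "Z_le \<alpha> (Z_of q) (Z_of p) \<longleftrightarrow> nonneg (p - q)"
proof -
  have key: "(a2 + b1, a1 + b2) \<in> N_le \<alpha> \<longleftrightarrow> nonneg (p - q)"
    if ab: "(a1, a2) \<in> Z_of p" "(b1, b2) \<in> Z_of q" for a1 a2 b1 b2
  proof -
    have "a2 + b1 \<in> N_set \<alpha>" "a1 + b2 \<in> N_set \<alpha>" using ab by (simp_all add: Z_of_iff N_set_add)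
    moreover have "int_poly (a1 + b2) - int_poly (a2 + b1) = p - q"
    proof -
      have "p = int_poly a1 - int_poly a2" "q = int_poly b1 - int_poly b2"
        using ab by (auto simp: Z_of_iff)
      then show ?thesis
        by (simp only: int_poly_add diff_diff_eq2 add_diff_eq diff_add_eq diff_diff_add add_ac)
    qed
    ultimately show ?thesis using N_le_iff[of "a2 + b1" "a1 + b2"] by simp
  qed
  obtain a1 a2 b1 b2 where ab: "(a1, a2) \<in> Z_of p" "(b1, b2) \<in> Z_of q"
    using Z_of_nonempty[OF assms(1)] Z_of_nonempty[OF assms(2)] by fast
  show ?thesis
  proof
    assume "Z_le \<alpha> (Z_of q) (Z_of p)"
    then show "nonneg (p - q)" using key by (auto simp: Z_le_def)
  next
    assume "nonneg (p - q)"
    then have "(a2 + b1, a1 + b2) \<in> N_le \<alpha>" using key[OF ab] by simp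
    then show "Z_le \<alpha> (Z_of q) (Z_of p)"
      unfolding Z_le_def by (intro bexI[OF _ ab(1)] case_prodI bexI[OF _ ab(2)])
  qed
qed

section \<open>Classes of fractions and their order\<close>

definition Z_pair :: "(('a \<Rightarrow>\<^sub>0 nat) \<Rightarrow>\<^sub>0 int) \<times> (('a \<Rightarrow>\<^sub>0 nat) \<Rightarrow>\<^sub>0 int) \<Rightarrow> 'a Z_ord \<times> 'a Z_ord" where
  "Z_pair x = (Z_of (fst x), Z_of (snd x))"

definition Q_of :: "(('a \<Rightarrow>\<^sub>0 nat) \<Rightarrow>\<^sub>0 int) \<times> (('a \<Rightarrow>\<^sub>0 nat) \<Rightarrow>\<^sub>0 int) \<Rightarrow> 'a Q_ord" where
  "Q_of x = Z_pair ` {y \<in> fractions. frac_eq x y}"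

lemma fractions_polys:
  "x \<in> fractions \<Longrightarrow> fst x \<in> polys" "x \<in> fractions \<Longrightarrow> snd x \<in> polys"
  "x \<in> fractions \<Longrightarrow> snd x \<noteq> 0"
  by (auto simp: fractions_def)

lemma fractionsI: "a \<in> polys \<Longrightarrow> b \<in> polys \<Longrightarrow> b \<noteq> 0 \<Longrightarrow> (a, b) \<in> fractions"
  by (simp add: fractions_def)

lemma frac_eq_refl: "frac_eq x x"
  by (simp add: frac_eq_def mult.commute)

lemma Z_pair_eq_iff: "x \<in> fractions \<Longrightarrow> Z_pair x = Z_pair y \<longleftrightarrow> x = y"
  by (simp add: Z_pair_def Z_of_eq_iff fractions_polys prod_eq_iff)

lemma zero_in_polys: "0 \<in> polys"
  by (simp add: polys_def)

lemma Q_pairs_eq: "Q_pairs \<alpha> = Z_pair ` fractions"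
proof -
  have "Z_set \<alpha> - {Z_zero \<alpha>} = Z_of ` (polys - {0})"
    unfolding Z_set_eq Z_zero_eq using Z_of_eq_iff zero_in_polys by blast
  moreover have "Z_pair = (\<lambda>(p, q). (Z_of p, Z_of q))" by (auto simp: Z_pair_def)
  ultimately show ?thesis
    unfolding Q_pairs_def fractions_def by (simp add: image_paired_Times Z_set_eq)
qed

text \<open>\<open>Z_mult\<close> is multiplication of polynomials and \<open>Z_of\<close> is
  injective on \<open>polys\<close>, so \<open>Q_rel \<alpha>\<close> on pairs of classes is
  \<open>frac_eq\<close> on pairs of polynomials.\<close>

lemma Q_class_eq:
  assumes "x \<in> fractions"
  shows "Q_class \<alpha> (Z_of (fst x)) (Z_of (snd x)) = Q_of x"
proof -
  have eq: "(Z_pair x, Z_pair y) \<in> Q_rel \<alpha> \<longleftrightarrow> frac_eq x y" if y: "y \<in> fractions" for y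
  proof -
    have "Z_mult \<alpha> (Z_of (fst x)) (Z_of (snd y)) = Z_mult \<alpha> (Z_of (snd x)) (Z_of (fst y))
        \<longleftrightarrow> frac_eq x y"
      using assms y by (simp add: Z_mult_eq fractions_polys Z_of_eq_iff closed frac_eq_def)
    moreover have "Z_pair x \<in> Q_pairs \<alpha>" "Z_pair y \<in> Q_pairs \<alpha>"
      using assms y by (auto simp: Q_pairs_eq)
    ultimately show ?thesis by (simp add: Q_rel_def Z_pair_def)
  qed
  have "(Z_pair x, Y) \<in> Q_rel \<alpha> \<longleftrightarrow> Y \<in> Q_of x" for Y
  proof
    assume Y: "(Z_pair x, Y) \<in> Q_rel \<alpha>"
    then have "Y \<in> Q_pairs \<alpha>" by (auto simp: Q_rel_def)
    then obtain y where "y \<in> fractions" "Y = Z_pair y" by (auto simp: Q_pairs_eq)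
    then show "Y \<in> Q_of x" using Y eq by (simp add: Q_of_def)
  next
    assume "Y \<in> Q_of x"
    then obtain y where "y \<in> fractions" "frac_eq x y" "Y = Z_pair y" by (auto simp: Q_of_def)
    then show "(Z_pair x, Y) \<in> Q_rel \<alpha>" using eq by simp
  qed
  then show ?thesis by (auto simp: Q_class_def Z_pair_def)
qed

lemma Q_of_nonempty: "x \<in> fractions \<Longrightarrow> Q_of x \<noteq> {}"
  unfolding Q_of_def using frac_eq_refl[of x] by blast

lemma Q_of_eq_iff:
  assumes "x \<in> fractions" "y \<in> fractions"
  shows "Q_of x = Q_of y \<longleftrightarrow> frac_eq x y"
proof
  assume "Q_of x = Q_of y"
  moreover have "Z_pair y \<in> Q_of y" using assms frac_eq_refl by (auto simp: Q_of_def)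
  ultimately have "Z_pair y \<in> Q_of x" by simp
  then show "frac_eq x y" using assms by (auto simp: Q_of_def Z_pair_eq_iff)
next
  assume xy: "frac_eq x y"
  have "frac_eq x z \<longleftrightarrow> frac_eq y z" if "z \<in> fractions" for z
    using frac_eq_trans[OF assms that] frac_eq_trans[OF assms(2,1) that] xy frac_eq_sym by blast
  then have "{z \<in> fractions. frac_eq x z} = {z \<in> fractions. frac_eq y z}" by blast
  then show "Q_of x = Q_of y" by (simp add: Q_of_def)
qed

lemma Q_set_eq: "Q_set \<alpha> = Q_of ` fractions"
proof -
  have "Q_rel \<alpha> `` {Z_pair x} = Q_of x" if "x \<in> fractions" for x
    using Q_class_eq[OF that] by (simp add: Q_class_def Z_pair_def)
  then show ?thesis unfolding Q_set_def quotient_def Q_pairs_eq by auto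
qed

lemma Q_of_repE:
  assumes "(A, B) \<in> Q_of x"
  obtains c d where "A = Z_of c" "B = Z_of d" "(c, d) \<in> fractions" "frac_eq x (c, d)"
  using assms by (auto simp: Q_of_def Z_pair_def)

lemma Q_add_eq:
  assumes x: "x \<in> fractions" and y: "y \<in> fractions"
  shows "Q_add \<alpha> (Q_of x) (Q_of y) = Q_of (fst x * snd y + snd x * fst y, snd x * snd y)"
  unfolding Q_add_def
proof (intro UN_pairs_const Q_of_nonempty assms)
  fix A B C D assume "(A, B) \<in> Q_of x" "(C, D) \<in> Q_of y"
  then obtain c d e f where rep: "A = Z_of c" "B = Z_of d" "C = Z_of e" "D = Z_of f"
    and cd: "(c, d) \<in> fractions" "frac_eq x (c, d)" and ef: "(e, f) \<in> fractions" "frac_eq y (e, f)"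
    by (elim Q_of_repE)
  have S: "c \<in> polys" "d \<in> polys" "e \<in> polys" "f \<in> polys" "d \<noteq> 0" "f \<noteq> 0"
    using fractions_polys[OF cd(1)] fractions_polys[OF ef(1)] by simp_all
  have frac: "(c * f + d * e, d * f) \<in> fractions"
    using S by (intro fractionsI closed mult_nonzero)
  have frac': "(fst x * snd y + snd x * fst y, snd x * snd y) \<in> fractions"
    using fractions_polys[OF x] fractions_polys[OF y] by (intro fractionsI closed mult_nonzero)
  \<comment> \<open>Regrouped so that the equations \<open>fst x * d = snd x * c\<close> and
    \<open>fst y * f = snd y * e\<close> of the two representatives can be inserted.\<close>
  have "(fst x * snd y + snd x * fst y) * (d * f)
      = (fst x * d) * (snd y * f) + (fst y * f) * (snd x * d)"
    by (simp only: distrib_left distrib_right mult_ac)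
  also have "\<dots> = (snd x * c) * (snd y * f) + (snd y * e) * (snd x * d)"
    using cd(2) ef(2) by (simp add: frac_eq_def)
  also have "\<dots> = (snd x * snd y) * (c * f + d * e)"
    by (simp only: distrib_left mult_ac)
  finally have "frac_eq (fst x * snd y + snd x * fst y, snd x * snd y) (c * f + d * e, d * f)"
    by (simp add: frac_eq_def)
  then have "Q_of (c * f + d * e, d * f) = Q_of (fst x * snd y + snd x * fst y, snd x * snd y)"
    using Q_of_eq_iff[OF frac' frac] by simp
  then show "Q_class \<alpha> (Z_add \<alpha> (Z_mult \<alpha> A D) (Z_mult \<alpha> B C)) (Z_mult \<alpha> B D)
      = Q_of (fst x * snd y + snd x * fst y, snd x * snd y)"
    using Q_class_eq[OF frac] S by (simp add: rep Z_mult_eq Z_add_eq closed)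
qed

lemma Q_uminus_eq:
  assumes x: "x \<in> fractions"
  shows "Q_uminus \<alpha> (Q_of x) = Q_of (- fst x, snd x)"
  unfolding Q_uminus_def
proof (intro UN_pairs_const Q_of_nonempty assms)
  fix A B assume "(A, B) \<in> Q_of x"
  then obtain c d where rep: "A = Z_of c" "B = Z_of d"
    and cd: "(c, d) \<in> fractions" "frac_eq x (c, d)" by (elim Q_of_repE)
  have S: "c \<in> polys" "d \<in> polys" "d \<noteq> 0" using fractions_polys[OF cd(1)] by simp_all
  have frac: "(- c, d) \<in> fractions" "(- fst x, snd x) \<in> fractions"
    using S fractions_polys[OF x] by (simp_all add: fractionsI closed)
  have "frac_eq (- fst x, snd x) (- c, d)" using cd(2) by (simp add: frac_eq_def)
  then have "Q_of (- c, d) = Q_of (- fst x, snd x)" using Q_of_eq_iff[OF frac(2,1)] by simp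
  then show "Q_class \<alpha> (Z_uminus \<alpha> A) B = Q_of (- fst x, snd x)"
    using Q_class_eq[OF frac(1)] S by (simp add: rep Z_uminus_eq)
qed

text \<open>\<open>Q_nonneg\<close> asks for a single suitable representative. Equivalent fractions
  have numerator-denominator products that agree after multiplication by nonzero squares, so the
  choice does not affect the sign.\<close>

lemma Q_nonneg_iff:
  assumes x: "x \<in> fractions"
  shows "Q_nonneg \<alpha> (Q_of x) \<longleftrightarrow> nonneg (fst x * snd x)"
proof
  assume "Q_nonneg \<alpha> (Q_of x)"
  then obtain A B where "(A, B) \<in> Q_of x" and le: "Z_le \<alpha> (Z_zero \<alpha>) (Z_mult \<alpha> A B)"
    by (auto simp: Q_nonneg_def)
  then obtain c d where rep: "A = Z_of c" "B = Z_of d"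
    and cd: "(c, d) \<in> fractions" "frac_eq x (c, d)" by (elim Q_of_repE)
  have S: "c \<in> polys" "d \<in> polys" "d \<noteq> 0" using fractions_polys[OF cd(1)] by simp_all
  note Sx = fractions_polys[OF x]
  have "Z_le \<alpha> (Z_of 0) (Z_of (c * d))" using le S by (simp add: rep Z_zero_eq Z_mult_eq)
  then have "nonneg (c * d)" using Z_le_iff[of "c * d" 0] S zero_in_polys by (simp add: closed)
  then have "nonneg ((c * d) * (snd x * snd x))"
    using S Sx by (intro nonneg_mult_square closed)
  moreover have "(c * d) * (snd x * snd x) = (fst x * snd x) * (d * d)"
  proof -
    have "(c * d) * (snd x * snd x) = (snd x * c) * (snd x * d)" by (simp only: mult_ac)
    also have "\<dots> = (fst x * d) * (snd x * d)" using cd(2) by (simp add: frac_eq_def)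
    finally show ?thesis by (simp only: mult_ac)
  qed
  ultimately have "nonneg ((fst x * snd x) * (d * d))" by simp
  then show "nonneg (fst x * snd x)"
    by (rule nonneg_cancel[rotated 3]) (use S Sx in \<open>simp_all add: closed pos_square\<close>)
next
  assume "nonneg (fst x * snd x)"
  then have "Z_le \<alpha> (Z_zero \<alpha>) (Z_mult \<alpha> (Z_of (fst x)) (Z_of (snd x)))"
    using Z_le_iff[of "fst x * snd x" 0] fractions_polys[OF x] zero_in_polys
    by (simp add: Z_zero_eq Z_mult_eq closed)
  moreover have "Z_pair x \<in> Q_of x" using x frac_eq_refl by (auto simp: Q_of_def)
  ultimately show "Q_nonneg \<alpha> (Q_of x)"
    unfolding Q_nonneg_def Z_pair_def by (intro bexI[of _ "(Z_of (fst x), Z_of (snd x))"]) simp_all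
qed

lemma Q_le_iff:
  assumes x: "x \<in> fractions" and y: "y \<in> fractions"
  shows "Q_le \<alpha> (Q_of x) (Q_of y) \<longleftrightarrow> frac_le x y"
proof -
  note S = fractions_polys[OF x] fractions_polys[OF y]
  have ux: "(- fst x, snd x) \<in> fractions" using S by (simp add: fractionsI closed)
  have "(fst y * snd x + snd y * (- fst x), snd y * snd x) \<in> fractions"
    using S by (intro fractionsI closed mult_nonzero)
  then show ?thesis
    using Q_add_eq[OF y ux] Q_nonneg_iff by (simp add: Q_le_def Q_uminus_eq[OF x] frac_le_def)
qed

lemma dense_order_on_Q: "dense_order_on (Q_set \<alpha>) (Q_le \<alpha>)"
proof
  fix X Y assume XY: "X \<in> Q_set \<alpha>" "Y \<in> Q_set \<alpha>"
  then obtain x y where x: "x \<in> fractions" "X = Q_of x" and y: "y \<in> fractions" "Y = Q_of y"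
    by (auto simp: Q_set_eq)
  show "Q_le \<alpha> X Y \<or> Q_le \<alpha> Y X"
    using frac_le_total[OF x(1) y(1)] x y by (simp add: Q_le_iff)
  show "X = Y" if "Q_le \<alpha> X Y" "Q_le \<alpha> Y X"
    using frac_le_antisym[OF x(1) y(1)] that x y by (simp add: Q_le_iff Q_of_eq_iff)
  show "Q_le \<alpha> X Z" if "Z \<in> Q_set \<alpha>" "Q_le \<alpha> X Y" "Q_le \<alpha> Y Z" for Z
  proof -
    obtain z where z: "z \<in> fractions" "Z = Q_of z" using \<open>Z \<in> Q_set \<alpha>\<close> by (auto simp: Q_set_eq)
    then show ?thesis
      using frac_le_trans[OF x(1) y(1) z(1)] that(2,3) x y by (simp add: Q_le_iff)
  qed
  show "\<exists>Z\<in>Q_set \<alpha>. Q_le \<alpha> X Z \<and> X \<noteq> Z \<and> Q_le \<alpha> Z Y \<and> Z \<noteq> Y" if "Q_le \<alpha> X Y" "X \<noteq> Y"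
  proof -
    have "frac_le x y" "\<not> frac_eq x y" using that x y by (simp_all add: Q_le_iff Q_of_eq_iff)
    then obtain z where z: "z \<in> fractions" "frac_le x z" "\<not> frac_eq x z" "frac_le z y" "\<not> frac_eq z y"
      using frac_le_dense[OF x(1) y(1)] by blast
    then show ?thesis
      using x y by (intro bexI[of _ "Q_of z"]) (simp_all add: Q_le_iff Q_of_eq_iff Q_set_eq)
  qed
next
  fix X assume "X \<in> Q_set \<alpha>"
  then show "Q_le \<alpha> X X" using frac_le_refl by (auto simp: Q_set_eq Q_le_iff)
qed

end

theorem mainTheorem3:
  fixes \<alpha> :: "'a rel"
  assumes "Well_order \<alpha>"
  shows "connected_space (order_topology_on (R_bar \<alpha>) cut_le)"
proof -
  interpret omega_polynomials \<alpha> by unfold_locales (rule assms)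
  show ?thesis
    unfolding R_bar_def by (rule dense_order_on.connected_space_cuts[OF dense_order_on_Q])
qed

end
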